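(* For $q=1,\dots,N$ define $\theta^{\{q\}}(\mathfrak t)\in\mathbb R^{s^{\{q\}}}$ for $\mathfrak t\in\mathbb{TW}_N$ recursively by: $\theta^{\{q\}}(\emptyset)=0$; $\theta^{\{q\}}(\tau_{\bigcirc q})=\mathbf 1^{\{q\}}$; $\theta^{\{q\}}([\mathfrak t_1,\dots,\mathfrak t_L]_{\bigcirc q})=\times_{\ell=1}^L\big(\sum_{m=1}^N\alpha^{\{q,m\}}\theta^{\{m\}}(\mathfrak t_\ell)\big)$ for $L\ge1$; $\theta^{\{q\}}([\mathfrak t_1]_{\square q})=\sum_{m=1}^N\gamma^{\{q,m\}}\theta^{\{m\}}(\mathfrak t_1)$; and $\theta^{\{q\}}(\mathfrak t)=0$ if the root of $\mathfrak t$ has color different from $q$. Let $\phi(\mathfrak t)=\sum_{m=1}^N b^{\{m\}T}\theta^{\{m\}}(\mathfrak t)$. Then the GARK-ROW method has order $p$ for arbitrary matrices $\mathbf L^{\{1\}},\dots,\mathbf L^{\{N\}}$ if and only if, for all $\mathfrak t\in\mathbb{TW}_N$ with $1\le\rho(\mathfrak t)\le p$, $$\phi(\mathfrak t)=\frac1{\gamma(\mathfrak t)}\ \text{ if }\mathfrak t\in\mathbb T_N,\qquad \phi(\mathfrak t)=0\ \text{ if }\mathfrak t\in\mathbb{TW}_N\setminus\mathbb T_N.$$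
   Context: Problem: $\mathbf y'=\sum_{m=1}^N\mathbf f^{\{m\}}(\mathbf y)$, $\mathbf y\in\mathbb R^d$, smooth $\mathbf f^{\{m\}}$. GARK-ROW method: for each $q$ stages $s^{\{q\}}$, weights $b^{\{q\}}\in\mathbb R^{s^{\{q\}}}$, matrices $\alpha^{\{q,m\}},\gamma^{\{q,m\}}\in\mathbb R^{s^{\{q\}}\times s^{\{m\}}}$ with $\alpha^{\{q,m\}}_{i,j}=0$ for $j\ge i$, $\gamma^{\{q,m\}}_{i,j}=0$ for $j>i$. One step: $k_i^{\{q\}}=h\,\mathbf f^{\{q\}}\big(\mathbf y_n+\sum_{m}\sum_{j<i}\alpha^{\{q,m\}}_{i,j}k_j^{\{m\}}\big)+h\,\mathbf L^{\{q\}}\sum_{m}\sum_{j\le i}\gamma^{\{q,m\}}_{i,j}k_j^{\{m\}}$, $\mathbf y_{n+1}=\mathbf y_n+\sum_q\sum_ib^{\{q\}}_ik_i^{\{q\}}$, where $\mathbf L^{\{q\}}\in\mathbb R^{d\times d}$ are arbitrary (solution-independent) matrices. Order $p$: local error $O(h^{p+1})$. $\mathbf 1^{\{q\}}$ is the vector of ones in $\mathbb R^{s^{\{q\}}}$; $\times$ is componentwise product. Trees: $\mathbb{TW}_N$ is the set of rooted trees (including empty tree $\emptyset$) whose vertices are round ($\bigcirc$) or square ($\square$), each colored with one of $1,\dots,N$; square vertices have exactly one child (no square leaves). $\mathbb T_N\subset\mathbb{TW}_N$ consists of trees with only round vertices. $\tau_{\bigcirc m}$: single round vertex of color $m$; $[\mathfrak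 t_1,\dots,\mathfrak t_L]_{\bigcirc m}$: nonempty $\mathfrak t_i$ attached to a new round root of color $m$; $[\mathfrak t_1]_{\square m}$: nonempty $\mathfrak t_1$ attached to a new square root of color $m$. $\rho$: number of vertices. Density (distinct from the matrices $\gamma^{\{q,m\}}$): $\gamma(\emptyset)=\gamma(\tau_{\bigcirc m})=1$, $\gamma([\mathfrak t_1,\dots,\mathfrak t_L]_{\bigcirc m})=\rho(\mathfrak t)\prod_\ell\gamma(\mathfrak t_\ell)$, $\gamma([\mathfrak t_1]_{\square m})=\rho(\mathfrak t)\gamma(\mathfrak t_1)$. *)

theory Defs
  imports "HOL-Analysis.Analysis"
begin

section \<open>Coordinate model of R^d (dimension d arbitrary, quantified inside the order notion)\<close>

text \<open>A vector of R^d is represented as x :: nat => real with x i = 0 for i >= d.\<close>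

definition inV :: "nat \<Rightarrow> (nat \<Rightarrow> real) \<Rightarrow> bool" where
  "inV d x \<longleftrightarrow> (\<forall>i\<ge>d. x i = 0)"

definition edist :: "nat \<Rightarrow> (nat \<Rightarrow> real) \<Rightarrow> (nat \<Rightarrow> real) \<Rightarrow> real" where
  "edist d x y = sqrt (\<Sum>i<d. (x i - y i)^2)"

definition contV :: "nat \<Rightarrow> ((nat \<Rightarrow> real) \<Rightarrow> real) \<Rightarrow> bool" where
  "contV d g \<longleftrightarrow> (\<forall>x. inV d x \<longrightarrow> (\<forall>\<epsilon>>0. \<exists>\<delta>>0. \<forall>y. inV d y \<and> edist d x y < \<delta> \<longrightarrow> \<bar>g y - g x\<bar> < \<epsilon>))"

fun Ck :: "nat \<Rightarrow> nat \<Rightarrow> ((nat \<Rightarrow> real) \<Rightarrow> real) \<Rightarrow> bool" where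
  "Ck d 0 g = contV d g"
| "Ck d (Suc n) g = (contV d g \<and> (\<forall>i<d. \<exists>g'. (\<forall>x. inV d x \<longrightarrow>
      ((\<lambda>t. g (x(i := x i + t))) has_real_derivative g' x) (at 0)) \<and> Ck d n g'))"

definition smooth_fun :: "nat \<Rightarrow> ((nat \<Rightarrow> real) \<Rightarrow> real) \<Rightarrow> bool" where
  "smooth_fun d g \<longleftrightarrow> (\<forall>n. Ck d n g)"

definition smooth_field :: "nat \<Rightarrow> ((nat \<Rightarrow> real) \<Rightarrow> (nat \<Rightarrow> real)) \<Rightarrow> bool" where
  "smooth_field d F \<longleftrightarrow> (\<forall>x. inV d x \<longrightarrow> inV d (F x)) \<and> (\<forall>c<d. smooth_fun d (\<lambda>x. F x c))"

definition exact_sol :: "nat \<Rightarrow> nat \<Rightarrow> (nat \<Rightarrow> (nat \<Rightarrow> real) \<Rightarrow> (nat \<Rightarrow> real)) \<Rightarrow>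
    (nat \<Rightarrow> real) \<Rightarrow> real \<Rightarrow> (real \<Rightarrow> nat \<Rightarrow> real) \<Rightarrow> bool" where
  "exact_sol d N F y0 T y \<longleftrightarrow> y 0 = y0 \<and> (\<forall>t\<in>{0..T}. inV d (y t)) \<and>
     (\<forall>t\<in>{0..T}. \<forall>c<d. ((\<lambda>\<tau>. y \<tau> c) has_real_derivative (\<Sum>m<N. F m (y t) c)) (at t within {0..T}))"

text \<open>Coefficients: s q stages of partition q; b q i; alpha q m i j; gam q m i j
  (all indices 0-based). Stage vectors k q i :: nat => real.\<close>

definition stage_arg :: "nat \<Rightarrow> (nat \<Rightarrow> nat) \<Rightarrow> (nat \<Rightarrow> nat \<Rightarrow> nat \<Rightarrow> nat \<Rightarrow> real) \<Rightarrow>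
    (nat \<Rightarrow> real) \<Rightarrow> (nat \<Rightarrow> nat \<Rightarrow> nat \<Rightarrow> real) \<Rightarrow> nat \<Rightarrow> nat \<Rightarrow> nat \<Rightarrow> real" where
  "stage_arg N s alpha y0 k q i = (\<lambda>c. y0 c +
      (\<Sum>m<N. \<Sum>j<s m. if j < i then alpha q m i j * k m j c else 0))"

definition stage_sol :: "nat \<Rightarrow> nat \<Rightarrow> (nat \<Rightarrow> nat) \<Rightarrow> (nat \<Rightarrow> nat \<Rightarrow> nat \<Rightarrow> nat \<Rightarrow> real) \<Rightarrow>
    (nat \<Rightarrow> nat \<Rightarrow> nat \<Rightarrow> nat \<Rightarrow> real) \<Rightarrow> (nat \<Rightarrow> (nat \<Rightarrow> real) \<Rightarrow> (nat \<Rightarrow> real)) \<Rightarrow>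
    (nat \<Rightarrow> nat \<Rightarrow> nat \<Rightarrow> real) \<Rightarrow> (nat \<Rightarrow> real) \<Rightarrow> real \<Rightarrow> (nat \<Rightarrow> nat \<Rightarrow> nat \<Rightarrow> real) \<Rightarrow> bool" where
  "stage_sol d N s alpha gam F L y0 h k \<longleftrightarrow>
     (\<forall>q<N. \<forall>i<s q. inV d (k q i) \<and>
        (\<forall>c<d. k q i c = h * F q (stage_arg N s alpha y0 k q i) c
            + h * (\<Sum>e<d. L q c e * (\<Sum>m<N. \<Sum>j<s m. if j \<le> i then gam q m i j * k m j e else 0))))"

definition num_sol :: "nat \<Rightarrow> (nat \<Rightarrow> nat) \<Rightarrow> (nat \<Rightarrow> nat \<Rightarrow> real) \<Rightarrow> (nat \<Rightarrow> real) \<Rightarrow>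
    (nat \<Rightarrow> nat \<Rightarrow> nat \<Rightarrow> real) \<Rightarrow> nat \<Rightarrow> real" where
  "num_sol N s b y0 k = (\<lambda>c. y0 c + (\<Sum>q<N. \<Sum>i<s q. b q i * k q i c))"

definition gark_row_order :: "nat \<Rightarrow> (nat \<Rightarrow> nat) \<Rightarrow> (nat \<Rightarrow> nat \<Rightarrow> real) \<Rightarrow>
    (nat \<Rightarrow> nat \<Rightarrow> nat \<Rightarrow> nat \<Rightarrow> real) \<Rightarrow> (nat \<Rightarrow> nat \<Rightarrow> nat \<Rightarrow> nat \<Rightarrow> real) \<Rightarrow> nat \<Rightarrow> bool" where
  "gark_row_order N s b alpha gam p \<longleftrightarrow>
    (\<forall>d F L y0 T y. (\<forall>m<N. smooth_field d (F m)) \<longrightarrow> inV d y0 \<longrightarrow> T > 0 \<longrightarrow>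
       exact_sol d N F y0 T y \<longrightarrow>
       (\<exists>\<delta>>0. \<exists>C. \<forall>h. 0 < h \<and> h < \<delta> \<longrightarrow>
           (\<exists>k. stage_sol d N s alpha gam F L y0 h k) \<and>
           (\<forall>k. stage_sol d N s alpha gam F L y0 h k \<longrightarrow>
              (\<forall>c<d. \<bar>num_sol N s b y0 k c - y h c\<bar> \<le> C * h ^ (p + 1)))))"

section \<open>Trees TW_N (nonempty; children as lists)\<close>

datatype tw = Rnd nat "tw list" | Sq nat tw

fun wf_tw :: "nat \<Rightarrow> tw \<Rightarrow> bool" where
  "wf_tw N (Rnd m ts) = (m < N \<and> (\<forall>t\<in>set ts. wf_tw N t))"
| "wf_tw N (Sq m t) = (m < N \<and> wf_tw N t)"

fun round_only :: "tw \<Rightarrow> bool" where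
  "round_only (Rnd m ts) = (\<forall>t\<in>set ts. round_only t)"
| "round_only (Sq m t) = False"

fun rho :: "tw \<Rightarrow> nat" where
  "rho (Rnd m ts) = 1 + sum_list (map rho ts)"
| "rho (Sq m t) = 1 + rho t"

fun dens :: "tw \<Rightarrow> nat" where
  "dens (Rnd m ts) = rho (Rnd m ts) * prod_list (map dens ts)"
| "dens (Sq m t) = rho (Sq m t) * dens t"

fun theta :: "nat \<Rightarrow> (nat \<Rightarrow> nat) \<Rightarrow> (nat \<Rightarrow> nat \<Rightarrow> nat \<Rightarrow> nat \<Rightarrow> real) \<Rightarrow>
    (nat \<Rightarrow> nat \<Rightarrow> nat \<Rightarrow> nat \<Rightarrow> real) \<Rightarrow> nat \<Rightarrow> tw \<Rightarrow> nat \<Rightarrow> real" where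
  "theta N s alpha gam q (Rnd m ts) = (if m \<noteq> q then (\<lambda>i. 0) else
      (\<lambda>i. prod_list (map (\<lambda>t. \<Sum>m'<N. \<Sum>j<s m'. alpha q m' i j * theta N s alpha gam m' t j) ts)))"
| "theta N s alpha gam q (Sq m t) = (if m \<noteq> q then (\<lambda>i. 0) else
      (\<lambda>i. \<Sum>m'<N. \<Sum>j<s m'. gam q m' i j * theta N s alpha gam m' t j))"

definition phi :: "nat \<Rightarrow> (nat \<Rightarrow> nat) \<Rightarrow> (nat \<Rightarrow> nat \<Rightarrow> real) \<Rightarrow>
    (nat \<Rightarrow> nat \<Rightarrow> nat \<Rightarrow> nat \<Rightarrow> real) \<Rightarrow> (nat \<Rightarrow> nat \<Rightarrow> nat \<Rightarrow> nat \<Rightarrow> real) \<Rightarrow> tw \<Rightarrow> real" where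
  "phi N s b alpha gam t = (\<Sum>m<N. \<Sum>i<s m. b m i * theta N s alpha gam m t i)"

end

theory Submission
  imports Defs "HOL-Library.Landau_Symbols" "HOL-Computational_Algebra.Formal_Power_Series"
begin

text \<open>The weights with which tree vectors enter depend on the problem and are never computed.
  What matters is that the stages and the exact solution share them: the Taylor coefficients of the
  fields and the entries of \<open>L\<close> are the same in every slot, which is why one joint
  vector is tracked. Two obstacles precede the expansion. The stage equations are implicit, because
  the diagonal of \<open>gam\<close> couples the stages of equal index across all partitions;
  solvability for small steps is therefore proved block by block. Moreover the Taylor remainder is
  measured by the displacement from \<open>y0\<close>, so it becomes a power of h only after the
  displacements are known to be O(h). Smoothness is given by iterated partial derivatives only. The
  Taylor expansion therefore moves one coordinate at a time instead of following a segment. The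
  density comes from integration: a product of order n on a round root is divided by n + 1, the
  number of vertices of the new tree. A square root has exact entry 0 because \<open>L\<close> does
  not occur in the differential equation.\<close>

text \<open>Sufficiency: the vector fields are Taylor expanded at the initial value in \<^emph>\<open>words\<close> of
  coordinates (noncommutative monomials), so that no symmetry factors of trees ever appear. Inserting
  truncated power series in h into the stage equations and into the differential equation gains one
  order at a time, and at each order j the joint vector (coefficients of all stages, coefficient of
  the exact solution) stays in the linear span of the vectors \<open>(\<theta>(t), 1/\<gamma>(t) or 0)\<close> over the
  trees t with j vertices, because both recursions act multilinearly on subtrees. The order
  conditions say that the functional "quadrature of the stages minus exact solution" vanishes on
  these spans for \<open>j \<le> p\<close>.

  Necessity: for every tree there is a polynomial problem, with one coordinate per subtree, whose
  numerical and exact solutions are exactly \<open>\<phi>(t) h\<^sup>\<rho>\<close> and \<open>h\<^sup>\<rho> / \<gamma>(t)\<close> (or 0) in the coordinate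
  of t.\<close>

unbundle no vec_syntax
unbundle fps_syntax

section \<open>Tree coefficient vectors\<close>

text \<open>\<open>Some (q, i)\<close> is stage i of partition q; \<open>None\<close> is the exact solution, which takes part in the
  tree recursion like one further stage.\<close>

type_synonym slot = "(nat \<times> nat) option"

locale gark_row =
  fixes N :: nat and s :: "nat \<Rightarrow> nat" and alpha gam :: "nat \<Rightarrow> nat \<Rightarrow> nat \<Rightarrow> nat \<Rightarrow> real"
begin

definition tree_vec :: "tw \<Rightarrow> slot \<Rightarrow> real" where
  "tree_vec t x = (case x of None \<Rightarrow> (if round_only t then 1 / real (dens t) else 0)
     | Some (q, i) \<Rightarrow> theta N s alpha gam q t i)"

definition mix :: "(nat \<Rightarrow> nat \<Rightarrow> nat \<Rightarrow> nat \<Rightarrow> real) \<Rightarrow> nat \<Rightarrow> nat \<Rightarrow> (slot \<Rightarrow> real) \<Rightarrow> real" where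
  "mix A q i v = (\<Sum>m<N. \<Sum>j<s m. A q m i j * v (Some (m, j)))"

definition fps_mix :: "(nat \<Rightarrow> nat \<Rightarrow> nat \<Rightarrow> nat \<Rightarrow> real) \<Rightarrow> nat \<Rightarrow> nat \<Rightarrow> (slot \<Rightarrow> real fps) \<Rightarrow> real fps" where
  "fps_mix A q i Z = (\<Sum>m<N. \<Sum>j<s m. fps_const (A q m i j) * Z (Some (m, j)))"

lemma fps_mix_nth: "fps_mix A q i Z $ n = mix A q i (\<lambda>x. Z x $ n)"
  by (simp add: fps_mix_def mix_def fps_sum_nth)

lemma mix_zero [simp]: "mix A q i (\<lambda>_. 0) = 0"
  by (simp add: mix_def)

lemma mix_add_scaled: "mix A q i (\<lambda>x. v x + r * w x) = mix A q i v + r * mix A q i w"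
  by (simp add: mix_def sum.distrib sum_distrib_left algebra_simps)

definition graft_square :: "nat \<Rightarrow> (slot \<Rightarrow> real) \<Rightarrow> slot \<Rightarrow> real" where
  "graft_square q v x = (case x of None \<Rightarrow> 0
     | Some (q', i) \<Rightarrow> if q' = q then mix gam q i v else 0)"

text \<open>The coefficient of order n of a round root of colour q carrying the trees ts and the series Zs.\<close>

definition graft_round :: "nat \<Rightarrow> tw list \<Rightarrow> (slot \<Rightarrow> real fps) list \<Rightarrow> nat \<Rightarrow> slot \<Rightarrow> real" where
  "graft_round q ts Zs n x = (case x of
       None \<Rightarrow> (\<Prod>t\<leftarrow>ts. tree_vec t None) * (\<Prod>Z\<leftarrow>Zs. Z None) $ n / real (Suc (sum_list (map rho ts) + n))
     | Some (q', i) \<Rightarrow> if q' = q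
         then (\<Prod>t\<leftarrow>ts. mix alpha q i (tree_vec t)) * (\<Prod>Z\<leftarrow>Zs. fps_mix alpha q i Z) $ n else 0)"

lemma prod_round_density:
  "(\<Prod>t\<leftarrow>ts. tree_vec t None)
     = (if \<forall>t\<in>set ts. round_only t then 1 / real (prod_list (map dens ts)) else 0)"
  by (induction ts) (auto simp: tree_vec_def)

lemma tree_vec_Rnd: "tree_vec (Rnd q ts) = graft_round q ts [] 0"
proof
  fix x show "tree_vec (Rnd q ts) x = graft_round q ts [] 0 x"
  proof (cases x)
    case None
    then show ?thesis
      using prod_round_density[of ts] by (auto simp: graft_round_def) (auto simp: tree_vec_def algebra_simps)
  next
    case (Some p)
    then show ?thesis
      by (cases p) (auto simp: tree_vec_def graft_round_def mix_def)
  qed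
qed

lemma tree_vec_Sq: "tree_vec (Sq q t) = graft_square q (tree_vec t)"
  by (rule ext) (auto simp: tree_vec_def graft_square_def mix_def split: option.splits)

text \<open>Built by adding one multiple of a tree vector at a time, so that every linearity
  argument is an induction with a single tree per step. The index is the common number of vertices,
  which is the power of h.\<close>

inductive_set tree_span :: "nat \<Rightarrow> (slot \<Rightarrow> real) set" for n where
  zero: "(\<lambda>_. 0) \<in> tree_span n"
| add_tree: "v \<in> tree_span n \<Longrightarrow> wf_tw N t \<Longrightarrow> rho t = n \<Longrightarrow> (\<lambda>x. v x + r * tree_vec t x) \<in> tree_span n"

lemma tree_vec_in_span: "wf_tw N t \<Longrightarrow> rho t = n \<Longrightarrow> tree_vec t \<in> tree_span n"
  using tree_span.add_tree[OF tree_span.zero, of t n 1] by simp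

lemma tree_span_add_scaled:
  assumes "v \<in> tree_span n" "w \<in> tree_span n"
  shows "(\<lambda>x. v x + r * w x) \<in> tree_span n"
  using assms(2)
proof induction
  case zero
  then show ?case using assms(1) by simp
next
  case (add_tree w t r')
  then show ?case
    using tree_span.add_tree[of "\<lambda>x. v x + r * w x" n t "r * r'"] by (simp add: algebra_simps)
qed

lemma tree_span_scale: "w \<in> tree_span n \<Longrightarrow> (\<lambda>x. r * w x) \<in> tree_span n"
  using tree_span_add_scaled[OF tree_span.zero] by simp

lemma tree_span_sum:
  assumes "\<And>a. a \<in> A \<Longrightarrow> f a \<in> tree_span n"
  shows "(\<lambda>x. \<Sum>a\<in>A. f a x) \<in> tree_span n"
  using assms
proof (induction A rule: infinite_finite_induct)
  case (insert a A)
  then have "(\<lambda>x. (\<Sum>a\<in>A. f a x) + 1 * f a x) \<in> tree_span n"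
    by (intro tree_span_add_scaled) auto
  then show ?case using insert by (simp add: add.commute)
qed (auto intro: tree_span.zero)

text \<open>Reduces a linear operation on the span to its effect on tree vectors. Multilinear
  operations are handled through it one argument at a time.\<close>

lemma tree_span_linear_image:
  assumes "v \<in> tree_span j"
    and "H (\<lambda>_. 0) = (\<lambda>_. 0)"
    and "\<And>v w r. H (\<lambda>x. v x + r * w x) = (\<lambda>x. H v x + r * H w x)"
    and "\<And>t. wf_tw N t \<Longrightarrow> rho t = j \<Longrightarrow> H (tree_vec t) \<in> tree_span m"
  shows "H v \<in> tree_span m"
  using assms(1)
  by induction (auto simp: assms(2,3) intro: tree_span.zero tree_span_add_scaled assms(4))

lemma graft_square_in_span:
  assumes "q < N" "v \<in> tree_span n"
  shows "graft_square q v \<in> tree_span (Suc n)"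
  using assms(2)
proof (rule tree_span_linear_image)
  fix t assume "wf_tw N t" "rho t = n"
  then have "tree_vec (Sq q t) \<in> tree_span (Suc n)"
    using assms(1) by (intro tree_vec_in_span) auto
  then show "graft_square q (tree_vec t) \<in> tree_span (Suc n)" by (simp add: tree_vec_Sq)
qed (auto simp: graft_square_def fun_eq_iff mix_add_scaled split: option.splits)

text \<open>Induction on \<open>Zs\<close>: the order-j coefficient of the head series is a
  combination of trees with j vertices, and by linearity each of them may be moved to
  \<open>ts\<close>. When no series is left, the graft is the vector of \<open>Rnd q ts\<close>. The
  denominator is invariant under the move, since \<open>n\<close> drops by j while the vertex count
  of \<open>ts\<close> grows by j.\<close>

lemma graft_round_in_span:
  assumes "q < N" "\<And>t. t \<in> set ts \<Longrightarrow> wf_tw N t"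
    and "\<And>Z j. Z \<in> set Zs \<Longrightarrow> j \<le> n \<Longrightarrow> (\<lambda>x. Z x $ j) \<in> tree_span j"
  shows "graft_round q ts Zs n \<in> tree_span (Suc (sum_list (map rho ts) + n))"
  using assms(2,3)
proof (induction Zs arbitrary: ts n)
  case Nil
  show ?case
  proof (cases "n = 0")
    case True
    then show ?thesis
      using Nil assms(1) tree_vec_in_span[of "Rnd q ts"] by (auto simp: tree_vec_Rnd)
  next
    case False
    then have "graft_round q ts [] n = (\<lambda>_. 0)"
      by (auto simp: graft_round_def fun_eq_iff split: option.splits)
    then show ?thesis by (simp add: tree_span.zero)
  qed
next
  case (Cons Z Zs)
  \<comment> \<open>The part of the Cauchy product in which the head series supplies order j, with
    its coefficient replaced by a free vector \<open>v\<close>. It is linear in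
    \<open>v\<close>.\<close>
  define H where "H j v x = (case x of
       None \<Rightarrow> (\<Prod>t\<leftarrow>ts. tree_vec t None) * v None * (\<Prod>Z\<leftarrow>Zs. Z None) $ (n - j)
                 / real (Suc (sum_list (map rho ts) + n))
     | Some (q', i) \<Rightarrow> if q' = q
         then (\<Prod>t\<leftarrow>ts. mix alpha q i (tree_vec t)) * mix alpha q i v
                * (\<Prod>Z\<leftarrow>Zs. fps_mix alpha q i Z) $ (n - j) else 0)" for j v x
  have split: "graft_round q ts (Z # Zs) n = (\<lambda>x. \<Sum>j\<in>{0..n}. H j (\<lambda>x. Z x $ j) x)"
    by (rule ext) (auto simp: graft_round_def H_def fps_mult_nth fps_mix_nth sum_distrib_left
        sum_divide_distrib mult.assoc split: option.splits)
  have "H j (\<lambda>x. Z x $ j) \<in> tree_span (Suc (sum_list (map rho ts) + n))" if "j \<in> {0..n}" for j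
  proof (rule tree_span_linear_image[where j = j and H = "H j"])
    show "(\<lambda>x. Z x $ j) \<in> tree_span j" using Cons.prems(2)[of Z j] that by auto
    show "H j (\<lambda>_. 0) = (\<lambda>_. 0)" by (auto simp: H_def fun_eq_iff split: option.splits)
    show "H j (\<lambda>x. v x + r * w x) = (\<lambda>x. H j v x + r * H j w x)" for v w r
      by (auto simp: H_def fun_eq_iff mix_add_scaled add_divide_distrib algebra_simps
          split: option.splits)
    fix t assume t: "wf_tw N t" "rho t = j"
    have "graft_round q (ts @ [t]) Zs (n - j) \<in> tree_span (Suc (sum_list (map rho (ts @ [t])) + (n - j)))"
      using Cons.prems t by (intro Cons.IH) auto
    moreover have "graft_round q (ts @ [t]) Zs (n - j) = H j (tree_vec t)"
      using t that by (auto simp: H_def graft_round_def fun_eq_iff split: option.splits)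
    ultimately show "H j (tree_vec t) \<in> tree_span (Suc (sum_list (map rho ts) + n))"
      using t that by simp
  qed
  then show ?case unfolding split by (rule tree_span_sum)
qed

end

section \<open>Truncated expansions in the step size\<close>

text \<open>The step size is a function on an arbitrary filter, so that the same notion serves the
  exact solution (h itself, tending to 0 from the right) and pairs of a step size with a solution of
  its stage equations.\<close>

definition expands :: "'a filter \<Rightarrow> ('a \<Rightarrow> real) \<Rightarrow> nat \<Rightarrow> ('a \<Rightarrow> real) \<Rightarrow> real fps \<Rightarrow> bool" where
  "expands G h n f Z \<longleftrightarrow> (\<lambda>x. f x - (\<Sum>j\<le>n. Z $ j * h x ^ j)) \<in> O[G](\<lambda>x. h x ^ Suc n)"

lemma power_bigo_power:
  fixes h :: "'a \<Rightarrow> real"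
  assumes "(h \<longlongrightarrow> 0) G" "n \<le> m"
  shows "(\<lambda>x. h x ^ m) \<in> O[G](\<lambda>x. h x ^ n)"
proof -
  have "\<forall>\<^sub>F x in G. \<bar>h x\<bar> < 1"
    using tendstoD[OF assms(1), of 1] by simp
  then have "\<forall>\<^sub>F x in G. norm (h x ^ m) \<le> 1 * norm (h x ^ n)"
  proof eventually_elim
    case (elim x)
    then show ?case using assms(2) by (simp add: power_abs power_decreasing)
  qed
  then show ?thesis by (rule bigoI)
qed

lemma expands_add:
  "expands G h n f Y \<Longrightarrow> expands G h n g Z \<Longrightarrow> expands G h n (\<lambda>x. f x + g x) (Y + Z)"
  unfolding expands_def
  by (drule (1) sum_in_bigo(1)) (simp add: algebra_simps sum.distrib)

lemma expands_zero: "expands G h n (\<lambda>_. 0) 0"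
  by (simp add: expands_def)

lemma expands_scale:
  assumes "expands G h n f Z" shows "expands G h n (\<lambda>x. c * f x) (fps_const c * Z)"
proof -
  have "(\<lambda>x. c * (f x - (\<Sum>j\<le>n. Z $ j * h x ^ j))) \<in> O[G](\<lambda>x. h x ^ Suc n)"
    using assms unfolding expands_def by simp
  then show ?thesis
    by (simp add: expands_def right_diff_distrib sum_distrib_left mult.assoc)
qed

lemma expands_sum:
  "(\<And>a. a \<in> A \<Longrightarrow> expands G h n (f a) (Z a))
    \<Longrightarrow> expands G h n (\<lambda>x. \<Sum>a\<in>A. f a x) (\<Sum>a\<in>A. Z a)"
  by (induction A rule: infinite_finite_induct) (auto intro: expands_add expands_zero)

lemma expands_perturb:
  assumes "expands G h n g Z" "(\<lambda>x. f x - g x) \<in> O[G](\<lambda>x. h x ^ Suc n)"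
  shows "expands G h n f Z"
  using sum_in_bigo(1)[OF assms(2) assms(1)[unfolded expands_def]] by (simp add: expands_def)

lemma expands_bounded:
  assumes "(h \<longlongrightarrow> 0) G" "expands G h n f Z"
  shows "f \<in> O[G](\<lambda>_. 1)"
proof -
  have 1: "(\<lambda>x. h x ^ k) \<in> O[G](\<lambda>_. 1)" for k
    using power_bigo_power[OF assms(1), of 0 k] by simp
  have "(\<lambda>x. \<Sum>j\<le>n. Z $ j * h x ^ j) \<in> O[G](\<lambda>_. 1)"
    by (intro big_sum_in_bigo) (use 1 in auto)
  moreover have "(\<lambda>x. f x - (\<Sum>j\<le>n. Z $ j * h x ^ j)) \<in> O[G](\<lambda>_. 1)"
    using landau_o.big_trans[OF assms(2)[unfolded expands_def] 1] .
  ultimately show ?thesis using sum_in_bigo(1) by fastforce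
qed

lemma expands_one: "expands G h n (\<lambda>_. 1) 1"
proof -
  have "(\<Sum>j\<le>n. (1 :: real fps) $ j * r ^ j) = 1" for r :: real
    by (simp add: if_distrib[where f = "\<lambda>x. x * _"] cong: if_cong)
  then show ?thesis by (simp add: expands_def)
qed

text \<open>The product of the two truncations differs from the truncated Cauchy product only in
  terms with i + j > n.\<close>

lemma expands_poly_mult:
  assumes "(h \<longlongrightarrow> 0) G"
  shows "expands G h n (\<lambda>x. (\<Sum>i\<le>n. Y $ i * h x ^ i) * (\<Sum>j\<le>n. Z $ j * h x ^ j)) (Y * Z)"
proof -
  have "(\<Sum>i\<le>n. Y $ i * r ^ i) * (\<Sum>j\<le>n. Z $ j * r ^ j) - (\<Sum>k\<le>n. (Y * Z) $ k * r ^ k)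
      = (\<Sum>i\<le>n. \<Sum>j\<in>{n-i<..n}. Y $ i * Z $ j * r ^ (i + j))" for r :: real
  proof -
    have "(\<Sum>k\<le>n. (Y * Z) $ k * r ^ k) = (\<Sum>k\<le>n. \<Sum>i\<le>k. Y $ i * Z $ (k - i) * r ^ (i + (k - i)))"
      by (auto simp: fps_mult_nth sum_distrib_right atMost_atLeast0 intro!: sum.cong)
    also have "\<dots> = (\<Sum>i\<le>n. \<Sum>j\<le>n - i. Y $ i * Z $ j * r ^ (i + j))"
      by (subst sum.triangle_reindex_eq[symmetric])
        (auto simp: sum.Sigma intro!: sum.cong)
    finally have L: "(\<Sum>k\<le>n. (Y * Z) $ k * r ^ k) = \<dots>" .
    have "(\<Sum>j\<le>n. Y $ i * Z $ j * r ^ (i + j)) = (\<Sum>j\<le>n - i. Y $ i * Z $ j * r ^ (i + j))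
        + (\<Sum>j\<in>{n-i<..n}. Y $ i * Z $ j * r ^ (i + j))" for i
      by (subst sum.union_disjoint[symmetric]) (auto intro!: sum.cong)
    moreover have "(\<Sum>i\<le>n. Y $ i * r ^ i) * (\<Sum>j\<le>n. Z $ j * r ^ j)
       = (\<Sum>i\<le>n. \<Sum>j\<le>n. Y $ i * Z $ j * r ^ (i + j))"
      by (simp add: sum_product power_add mult_ac)
    ultimately show ?thesis by (simp add: L sum.distrib)
  qed
  moreover have "(\<lambda>x. \<Sum>i\<le>n. \<Sum>j\<in>{n-i<..n}. Y $ i * Z $ j * h x ^ (i + j)) \<in> O[G](\<lambda>x. h x ^ Suc n)"
    by (intro big_sum_in_bigo) (use power_bigo_power[OF assms, of "Suc n"] in auto)
  ultimately show ?thesis by (simp add: expands_def)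
qed

lemma expands_mult:
  assumes h: "(h \<longlongrightarrow> 0) G" and f: "expands G h n f Y" and g: "expands G h n g Z"
  shows "expands G h n (\<lambda>x. f x * g x) (Y * Z)"
proof (rule expands_perturb[OF expands_poly_mult[OF h]])
  define P where "P x = (\<Sum>i\<le>n. Y $ i * h x ^ i)" for x
  define Q where "Q x = (\<Sum>i\<le>n. Z $ i * h x ^ i)" for x
  have "expands G h n P Y" by (simp add: expands_def P_def)
  then have P: "P \<in> O[G](\<lambda>_. 1)" using expands_bounded[OF h] by blast
  \<comment> \<open>Uses f g - P Q = (f - P) g + P (g - Q), where \<open>g\<close> and
    \<open>P\<close> are bounded.\<close>
  have 1: "(\<lambda>x. (f x - P x) * g x) \<in> O[G](\<lambda>x. h x ^ Suc n * 1)"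
    by (rule landau_o.big.mult) (use f g expands_bounded[OF h] in \<open>auto simp: expands_def P_def\<close>)
  have 2: "(\<lambda>x. P x * (g x - Q x)) \<in> O[G](\<lambda>x. 1 * h x ^ Suc n)"
    by (rule landau_o.big.mult) (use g P in \<open>auto simp: expands_def Q_def\<close>)
  show "(\<lambda>x. f x * g x - P x * Q x) \<in> O[G](\<lambda>x. h x ^ Suc n)"
    using sum_in_bigo(1)[OF 1[unfolded mult_1_right] 2[unfolded mult_1_left]]
    by (simp add: algebra_simps)
qed

lemma expands_prod_list:
  assumes "(h \<longlongrightarrow> 0) G" "\<And>e. e \<in> set w \<Longrightarrow> expands G h n (f e) (Z e)"
  shows "expands G h n (\<lambda>x. \<Prod>e\<leftarrow>w. f e x) (\<Prod>e\<leftarrow>w. Z e)"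
  using assms(2) by (induction w) (auto intro: expands_one expands_mult assms(1))

text \<open>The explicit factor h in the stage equations is what gains one order per pass; for the
  differential equation, integration plays this role.\<close>

lemma expands_step_mult:
  assumes "expands G h n f Z"
  shows "expands G h (Suc n) (\<lambda>x. h x * f x) (fps_X * Z)"
proof -
  have "(\<lambda>x. h x * (f x - (\<Sum>j\<le>n. Z $ j * h x ^ j))) \<in> O[G](\<lambda>x. h x * h x ^ Suc n)"
    using assms unfolding expands_def by (intro landau_o.big.mult) auto
  moreover have "(\<Sum>j\<le>Suc n. (fps_X * Z) $ j * r ^ j) = r * (\<Sum>j\<le>n. Z $ j * r ^ j)" for r
    by (simp add: sum.atMost_Suc_shift sum_distrib_left mult_ac del: sum.atMost_Suc)
  ultimately show ?thesis by (simp add: expands_def right_diff_distrib)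
qed

lemma expands_compose:
  assumes "expands G h n f Z" "filterlim g G G'"
  shows "expands G' (\<lambda>x. h (g x)) n (\<lambda>x. f (g x)) Z"
  using assms unfolding expands_def by (rule landau_o.big.compose)

section \<open>Taylor expansion in words of coordinates\<close>

text \<open>The length bound is strict: these words form a Taylor polynomial of degree n - 1, whose
  remainder has order n.\<close>

definition words :: "nat \<Rightarrow> nat \<Rightarrow> nat list set" where
  "words d n = {w. set w \<subseteq> {..<d} \<and> length w < n}"

lemma finite_words [simp]: "finite (words d n)"
proof (rule finite_subset)
  show "words d n \<subseteq> {w. set w \<subseteq> {..<d} \<and> length w \<le> n}" by (auto simp: words_def)
qed (auto intro: finite_lists_length_le)

lemma words_0 [simp]: "words d 0 = {}"
  by (simp add: words_def)

lemma sum_words_Suc: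
  "(\<Sum>w\<in>words d (Suc n). f w) = f [] + (\<Sum>j<d. \<Sum>w\<in>words d n. f (j # w))"
proof -
  have "words d (Suc n) = insert [] ((\<lambda>(j, w). j # w) ` ({..<d} \<times> words d n))"
  proof (rule set_eqI)
    fix w show "w \<in> words d (Suc n) \<longleftrightarrow> w \<in> insert [] ((\<lambda>(j, w). j # w) ` ({..<d} \<times> words d n))"
      by (cases w) (auto simp: words_def)
  qed
  moreover have "inj_on (\<lambda>(j, w). j # w) ({..<d} \<times> words d n)"
    by (auto simp: inj_on_def)
  moreover have "[] \<notin> (\<lambda>(j, w). j # w) ` ({..<d} \<times> words d n)" by auto
  ultimately show ?thesis
    by (simp add: sum.reindex sum.cartesian_product split_def)
qed

text \<open>Moving from \<open>y0 + u\<close> truncated below coordinate j to \<open>y0 + u\<close> truncated below \<open>j + 1\<close> is a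
  one-variable problem; a word contributes only if none of its letters exceeds j, and the letter j
  occurring k times in it integrates to the power \<open>k + 1\<close>.\<close>

lemma word_primitive:
  fixes u :: "nat \<Rightarrow> real" and j :: nat
  defines "v \<equiv> (\<lambda>r e. if e < j then u e else if e = j then r else 0)"
  shows "((\<lambda>r. if \<forall>e\<in>set w. e \<le> j then (\<Prod>e\<leftarrow>j # w. v r e) / real (Suc (count_list w j)) else 0)
          has_real_derivative (\<Prod>e\<leftarrow>w. v r e)) (at r)"
proof (cases "\<forall>e\<in>set w. e \<le> j")
  case True
  \<comment> \<open>Letters below \<open>j\<close> are frozen at the values of \<open>u\<close>, so
    as a function of \<open>r\<close> the word is this constant times a power.\<close>
  define C where "C = (\<Prod>e\<leftarrow>filter (\<lambda>e. e \<noteq> j) w. u e)"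
  have *: "(\<Prod>e\<leftarrow>w. v r e) = C * r ^ count_list w j" for r
    using True unfolding C_def by (induction w) (auto simp: v_def)
  have "((\<lambda>r. r * (C * r ^ count_list w j) / real (Suc (count_list w j)))
      has_real_derivative C * r ^ count_list w j) (at r)"
  proof -
    have "((\<lambda>r. C * (r ^ Suc (count_list w j) / real (Suc (count_list w j))))
        has_real_derivative C * r ^ count_list w j) (at r)"
      using DERIV_cmult[OF DERIV_cdivide[OF DERIV_pow[of "Suc (count_list w j)" r UNIV]], of C "real (Suc (count_list w j))"]
      by (simp del: of_nat_Suc power_Suc)
    then show ?thesis by (simp add: mult_ac)
  qed
  moreover have "v r j = r" for r by (simp add: v_def)
  ultimately show ?thesis using True by (simp add: * del: of_nat_Suc)
next
  case False
  then obtain e where "e \<in> set w" "v r e = 0" by (auto simp: v_def not_le)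
  then have "(\<Prod>e\<leftarrow>w. v r e) = 0" by (metis image_eqI list.set_map prod_list_zero_iff)
  then show ?thesis unfolding if_not_P[OF False] by simp
qed

lemma edist_le:
  assumes "\<And>e. e < d \<Longrightarrow> \<bar>u e\<bar> \<le> r" "0 \<le> r"
  shows "edist d y (\<lambda>e. y e + u e) \<le> sqrt (real d) * r"
proof -
  have "(\<Sum>i<d. (y i - (y i + u i))\<^sup>2) \<le> (\<Sum>i<d. r\<^sup>2)"
    using assms by (intro sum_mono) (simp add: abs_le_square_iff[symmetric])
  then have "edist d y (\<lambda>e. y e + u e) \<le> sqrt (real d * r\<^sup>2)"
    unfolding edist_def by (intro real_sqrt_le_mono) simp
  then show ?thesis using assms(2) by (simp add: real_sqrt_mult)
qed

definition word_approx ::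
  "nat \<Rightarrow> (nat \<Rightarrow> real) \<Rightarrow> nat \<Rightarrow> ((nat \<Rightarrow> real) \<Rightarrow> real) \<Rightarrow> (nat list \<Rightarrow> real) \<Rightarrow> bool" where
  "word_approx d y0 n g a \<longleftrightarrow> (\<exists>K \<delta>. 0 < \<delta> \<and> 0 \<le> K \<and>
     (\<forall>u r. inV d u \<and> (\<forall>e<d. \<bar>u e\<bar> \<le> r) \<and> 0 \<le> r \<and> r < \<delta> \<longrightarrow>
      \<bar>g (\<lambda>e. y0 e + u e) - (\<Sum>w\<in>words d n. a w * (\<Prod>e\<leftarrow>w. u e))\<bar> \<le> K * r ^ n))"

text \<open>Induction on the order: the partial derivatives have word approximations of order n by
  hypothesis. The increment from \<open>y0\<close> to \<open>y0 + u\<close> telescopes over the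
  coordinates, and on each leg the mean value estimate turns the error K r^n of a partial derivative
  into K r^(n+1).\<close>

lemma word_taylor_bound:
  assumes "Ck d n g" "inV d y0"
  shows "\<exists>a K \<delta>. 0 < \<delta> \<and> 0 \<le> K \<and> (\<forall>u r. inV d u \<and> (\<forall>e<d. \<bar>u e\<bar> \<le> r) \<and> 0 \<le> r \<and> r < \<delta> \<longrightarrow>
      \<bar>g (\<lambda>e. y0 e + u e) - (\<Sum>w\<in>words d n. a w * (\<Prod>e\<leftarrow>w. u e))\<bar> \<le> K * r ^ n)"
  using assms(1)
proof (induction n arbitrary: g)
  case 0
  then obtain \<delta> where \<delta>: "\<delta> > 0" "\<And>y. inV d y \<Longrightarrow> edist d y0 y < \<delta> \<Longrightarrow> \<bar>g y - g y0\<bar> < 1"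
    using assms(2) unfolding Ck.simps contV_def by (metis zero_less_one)
  show ?case
  proof (intro exI conjI allI impI)
    \<comment> \<open>The factor sqrt d passes from the coordinatewise bound to the Euclidean
      distance; adding 1 keeps the quotient meaningful for d = 0.\<close>
    show "0 < \<delta> / (sqrt (real d) + 1)" using \<delta> by (simp add: add_nonneg_pos)
    show "0 \<le> \<bar>g y0\<bar> + 1" by simp
    fix u r assume *: "inV d u \<and> (\<forall>e<d. \<bar>u e\<bar> \<le> r) \<and> 0 \<le> r \<and> r < \<delta> / (sqrt (real d) + 1)"
    then have "(sqrt (real d) + 1) * r < \<delta>" by (simp add: pos_less_divide_eq add_nonneg_pos mult.commute)
    moreover have "edist d y0 (\<lambda>e. y0 e + u e) \<le> sqrt (real d) * r"
      using * by (intro edist_le) auto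
    ultimately have "edist d y0 (\<lambda>e. y0 e + u e) < \<delta>" using * by (auto simp: algebra_simps)
    moreover have "inV d (\<lambda>e. y0 e + u e)" using * assms(2) by (auto simp: inV_def)
    ultimately have "\<bar>g (\<lambda>e. y0 e + u e) - g y0\<bar> < 1" using \<delta> by blast
    then show "\<bar>g (\<lambda>e. y0 e + u e) - (\<Sum>w\<in>words d 0. undefined w * (\<Prod>e\<leftarrow>w. u e))\<bar> \<le> (\<bar>g y0\<bar> + 1) * r ^ 0"
      by simp
  qed
next
  case (Suc n)
  define R where "R j g' \<longleftrightarrow> (\<forall>x. inV d x \<longrightarrow>
      ((\<lambda>t. g (x(j := x j + t))) has_real_derivative g' x) (at 0)) \<and> Ck d n g'" for j g'
  have "\<forall>j. \<exists>g'. j < d \<longrightarrow> R j g'"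
    using Suc.prems by (auto simp: R_def)
  then obtain g' where R: "\<And>j. j < d \<Longrightarrow> R j (g' j)" by metis
  have g': "((\<lambda>t. g (x(j := x j + t))) has_real_derivative g' j x) (at 0)" if "j < d" "inV d x" for j x
    using R[OF that(1)] that(2) by (simp add: R_def)
  define Q where "Q j a K \<delta> \<longleftrightarrow> 0 < \<delta> \<and> 0 \<le> K \<and> (\<forall>u r. inV d u \<and> (\<forall>e<d. \<bar>u e\<bar> \<le> r) \<and> 0 \<le> r \<and> r < \<delta> \<longrightarrow>
      \<bar>g' j (\<lambda>e. y0 e + u e) - (\<Sum>w\<in>words d n. a w * (\<Prod>e\<leftarrow>w. u e))\<bar> \<le> K * r ^ n)" for j a K \<delta>
  have "\<exists>a K \<delta>. Q j a K \<delta>" if "j < d" for j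
    unfolding Q_def by (rule Suc.IH) (use R[OF that] in \<open>simp add: R_def\<close>)
  then obtain a K \<delta> where Q: "\<And>j. j < d \<Longrightarrow> Q j (a j) (K j) (\<delta> j)" by metis
  have IH: "0 < \<delta> j" "0 \<le> K j" if "j < d" for j
    using Q[OF that] by (simp_all add: Q_def)
  have IH3: "\<bar>g' j (\<lambda>e. y0 e + u e) - (\<Sum>w\<in>words d n. a j w * (\<Prod>e\<leftarrow>w. u e))\<bar> \<le> K j * r ^ n"
    if "j < d" "inV d u" "\<forall>e<d. \<bar>u e\<bar> \<le> r" "0 \<le> r" "r < \<delta> j" for j u r
    using Q[OF that(1)] that by (simp add: Q_def)
  \<comment> \<open>When coordinate \<open>j\<close> moves, the coordinates above it are still 0.
    Hence only words led by a largest letter receive a coefficient, and the divisor comes from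
    integrating the power of that letter.\<close>
  define a' where "a' w = (case w of [] \<Rightarrow> g y0
      | j # w \<Rightarrow> if \<forall>e\<in>set w. e \<le> j then a j w / real (Suc (count_list w j)) else 0)" for w
  \<comment> \<open>The inserted 1 keeps the minimum defined for d = 0.\<close>
  define D where "D = Min (insert 1 (\<delta> ` {..<d}))"
  have D: "0 < D" "\<And>j. j < d \<Longrightarrow> D \<le> \<delta> j"
    using IH(1) by (auto simp: D_def)
  show ?case
  proof (intro exI conjI allI impI)
    show "0 < D" by fact
    show "0 \<le> (\<Sum>j<d. K j)" using IH(2) by (auto intro: sum_nonneg)
    fix u r assume *: "inV d u \<and> (\<forall>e<d. \<bar>u e\<bar> \<le> r) \<and> 0 \<le> r \<and> r < D"
    define v where "v j t e = (if e < j then u e else if e = j then t else 0)" for j t e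
    define P where "P j = (\<lambda>t. \<Sum>w\<in>words d n. a j w *
       (if \<forall>e\<in>set w. e \<le> j then (\<Prod>e\<leftarrow>j # w. v j t e) / real (Suc (count_list w j)) else 0))" for j
    \<comment> \<open>\<open>P j\<close> is a primitive of the word polynomial of the
      \<open>j\<close>-th partial derivative, so the derivative of \<open>G j\<close> is exactly the
      remainder bounded by the induction hypothesis.\<close>
    define G where "G j = (\<lambda>t. g (\<lambda>e. y0 e + v j t e) - P j t)" for j
    have step: "\<bar>G j (u j) - G j 0\<bar> \<le> K j * r ^ Suc n" if j: "j < d" for j
    proof -
      have uj: "u j \<in> {-r..r}" using * j abs_le_D1[of "u j" r] abs_le_D2[of "u j" r] by force
      have inV: "inV d (v j t)" for t using * j by (auto simp: v_def inV_def)
      have upd: "(\<lambda>e. y0 e + v j t e)(j := (\<lambda>e. y0 e + v j t e) j + x) = (\<lambda>e. y0 e + v j (t + x) e)" for t x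
        by (auto simp: v_def fun_eq_iff)
      have "((\<lambda>x. g (\<lambda>e. y0 e + v j (t + x) e)) has_real_derivative g' j (\<lambda>e. y0 e + v j t e)) (at 0)" for t
        using g'[OF j, of "\<lambda>e. y0 e + v j t e"] inV[of t] assms(2) unfolding upd
        by (auto simp: inV_def)
      then have dg: "((\<lambda>t. g (\<lambda>e. y0 e + v j t e)) has_real_derivative g' j (\<lambda>e. y0 e + v j t e)) (at t)" for t
        using DERIV_at_within_shift[of "\<lambda>t. g (\<lambda>e. y0 e + v j t e)" _ t 0 UNIV] by simp
      have dP: "(P j has_real_derivative (\<Sum>w\<in>words d n. a j w * (\<Prod>e\<leftarrow>w. v j t e))) (at t)" for t
        unfolding P_def v_def by (intro DERIV_sum DERIV_cmult word_primitive)
      have "norm (G j (u j) - G j 0) \<le> K j * r ^ n * norm (u j - 0)"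
      proof (rule field_differentiable_bound[where S = "{-r..r}"])
        fix t assume t: "t \<in> {-r..r}"
        show "(G j has_real_derivative g' j (\<lambda>e. y0 e + v j t e)
            - (\<Sum>w\<in>words d n. a j w * (\<Prod>e\<leftarrow>w. v j t e))) (at t within {-r..r})"
          unfolding G_def by (rule has_field_derivative_at_within, intro DERIV_diff dg dP)
        have "\<forall>e<d. \<bar>v j t e\<bar> \<le> r" using t * by (auto simp: v_def)
        then show "norm (g' j (\<lambda>e. y0 e + v j t e) - (\<Sum>w\<in>words d n. a j w * (\<Prod>e\<leftarrow>w. v j t e))) \<le> K j * r ^ n"
          using IH3[OF j inV, of t r] * D(2)[OF j] by auto
      qed (use * uj in auto)
      also have "\<dots> \<le> K j * r ^ n * r"
        using * j IH(2)[OF j] by (intro mult_left_mono) auto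
      finally show ?thesis by (simp add: mult_ac)
    qed
    have nxt: "v (Suc j) 0 = v j (u j)" for j by (auto simp: v_def fun_eq_iff less_Suc_eq)
    have P0: "P j 0 = 0" for j by (auto simp: P_def v_def intro!: sum.neutral)
    have ends: "v 0 0 = (\<lambda>_. 0)" "v d 0 = u" using * by (auto simp: v_def fun_eq_iff inV_def)
    have "(\<Sum>j<d. G j (u j) - G j 0) = (\<Sum>j<d. g (\<lambda>e. y0 e + v (Suc j) 0 e) - g (\<lambda>e. y0 e + v j 0 e)) - (\<Sum>j<d. P j (u j))"
      by (simp add: G_def nxt P0 sum_subtractf)
    also have "(\<Sum>j<d. g (\<lambda>e. y0 e + v (Suc j) 0 e) - g (\<lambda>e. y0 e + v j 0 e)) = g (\<lambda>e. y0 e + u e) - g y0"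
      by (subst sum_lessThan_telescope) (simp add: ends)
    also have "(\<Sum>j<d. P j (u j)) = (\<Sum>j<d. \<Sum>w\<in>words d n. a' (j # w) * (\<Prod>e\<leftarrow>j # w. u e))"
    proof (intro sum.cong refl, unfold P_def, intro sum.cong refl)
      fix j w
      show "a j w * (if \<forall>e\<in>set w. e \<le> j then (\<Prod>e\<leftarrow>j # w. v j (u j) e) / real (Suc (count_list w j)) else 0)
         = a' (j # w) * (\<Prod>e\<leftarrow>j # w. u e)"
      proof (cases "\<forall>e\<in>set w. e \<le> j")
        case True
        then have "(\<Prod>e\<leftarrow>w. v j (u j) e) = (\<Prod>e\<leftarrow>w. u e)"
          by (intro arg_cong[where f = prod_list] map_cong) (auto simp: v_def)
        then show ?thesis using True by (simp add: a'_def v_def[of _ _ j])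
      qed (auto simp: a'_def)
    qed
    finally have "g (\<lambda>e. y0 e + u e) - (\<Sum>w\<in>words d (Suc n). a' w * (\<Prod>e\<leftarrow>w. u e)) = (\<Sum>j<d. G j (u j) - G j 0)"
      by (simp add: sum_words_Suc a'_def)
    also have "\<bar>\<dots>\<bar> \<le> (\<Sum>j<d. K j * r ^ Suc n)"
      by (rule order_trans[OF sum_abs sum_mono]) (use step in auto)
    finally show "\<bar>g (\<lambda>e. y0 e + u e) - (\<Sum>w\<in>words d (Suc n). a' w * (\<Prod>e\<leftarrow>w. u e))\<bar> \<le> (\<Sum>j<d. K j) * r ^ Suc n"
      by (simp add: sum_distrib_right)
  qed
qed

lemma word_taylor: "Ck d n g \<Longrightarrow> inV d y0 \<Longrightarrow> \<exists>a. word_approx d y0 n g a"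
  unfolding word_approx_def by (rule word_taylor_bound)

text \<open>The sum of the absolute displacements serves as radius: it dominates each coordinate and
  is O(h), hence eventually below the radius of validity.\<close>

lemma word_approx_bigo:
  fixes u :: "'a \<Rightarrow> nat \<Rightarrow> real"
  assumes a: "word_approx d y0 n g a" and h: "(h \<longlongrightarrow> 0) G"
    and u: "\<And>e. e < d \<Longrightarrow> (\<lambda>x. u x e) \<in> O[G](h)" and inV: "\<forall>\<^sub>F x in G. inV d (u x)"
  shows "(\<lambda>x. g (\<lambda>e. y0 e + u x e) - (\<Sum>w\<in>words d n. a w * (\<Prod>e\<leftarrow>w. u x e))) \<in> O[G](\<lambda>x. h x ^ n)"
proof -
  obtain K \<delta> where K: "0 < \<delta>" "0 \<le> K" "\<And>u r. inV d u \<Longrightarrow> (\<forall>e<d. \<bar>u e\<bar> \<le> r) \<Longrightarrow> 0 \<le> r \<Longrightarrow> r < \<delta> \<Longrightarrow>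
      \<bar>g (\<lambda>e. y0 e + u e) - (\<Sum>w\<in>words d n. a w * (\<Prod>e\<leftarrow>w. u e))\<bar> \<le> K * r ^ n"
    using a unfolding word_approx_def by blast
  define r where "r x = (\<Sum>e<d. \<bar>u x e\<bar>)" for x
  have r: "r \<in> O[G](h)"
    unfolding r_def by (intro big_sum_in_bigo) (use u in auto)
  then obtain C where C: "C > 0" "\<forall>\<^sub>F x in G. norm (r x) \<le> C * norm (h x)"
    by (elim landau_o.bigE)
  have "(r \<longlongrightarrow> 0) G"
    using C(2) by (rule Lim_null_comparison) (use h in \<open>auto intro!: tendsto_mult_right_zero tendsto_rabs_zero\<close>)
  then have "\<forall>\<^sub>F x in G. r x < \<delta>" using K(1) order_tendstoD(2) by blast
  with inV have "\<forall>\<^sub>F x in G. norm (g (\<lambda>e. y0 e + u x e) - (\<Sum>w\<in>words d n. a w * (\<Prod>e\<leftarrow>w. u x e)))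
      \<le> K * norm (r x ^ n)"
  proof eventually_elim
    case (elim x)
    have "\<bar>u x e\<bar> \<le> r x" if "e < d" for e
      unfolding r_def using that by (intro member_le_sum) auto
    moreover have "0 \<le> r x" by (simp add: r_def sum_nonneg)
    ultimately show ?case using K(3)[of "u x" "r x"] elim by simp
  qed
  then have "(\<lambda>x. g (\<lambda>e. y0 e + u x e) - (\<Sum>w\<in>words d n. a w * (\<Prod>e\<leftarrow>w. u x e))) \<in> O[G](\<lambda>x. r x ^ n)"
    by (rule bigoI)
  also have "(\<lambda>x. r x ^ n) \<in> O[G](\<lambda>x. h x ^ n)"
    using r by (rule landau_o.big_power)
  finally show ?thesis .
qed

text \<open>The word polynomial is expanded letter by letter. Its remainder O(h^p) is negligible at
  order \<open>n\<close> because \<open>n < p\<close>.\<close>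

lemma word_approx_expands:
  fixes u :: "'a \<Rightarrow> nat \<Rightarrow> real"
  assumes "word_approx d y0 p g a" "n < p" "(h \<longlongrightarrow> 0) G"
    and "\<And>e. e < d \<Longrightarrow> (\<lambda>x. u x e) \<in> O[G](h)" "\<forall>\<^sub>F x in G. inV d (u x)"
    and Z: "\<And>e. e < d \<Longrightarrow> expands G h n (\<lambda>x. u x e) (Z e)"
  shows "expands G h n (\<lambda>x. g (\<lambda>e. y0 e + u x e))
    (\<Sum>w\<in>words d p. fps_const (a w) * (\<Prod>e\<leftarrow>w. Z e))"
proof (rule expands_perturb)
  show "expands G h n (\<lambda>x. \<Sum>w\<in>words d p. a w * (\<Prod>e\<leftarrow>w. u x e))
    (\<Sum>w\<in>words d p. fps_const (a w) * (\<Prod>e\<leftarrow>w. Z e))"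
    by (intro expands_sum expands_scale expands_prod_list assms(3) Z) (auto simp: words_def)
  show "(\<lambda>x. g (\<lambda>e. y0 e + u x e) - (\<Sum>w\<in>words d p. a w * (\<Prod>e\<leftarrow>w. u x e))) \<in> O[G](\<lambda>x. h x ^ Suc n)"
    using landau_o.big_trans[OF word_approx_bigo[OF assms(1,3-5)] power_bigo_power[OF assms(3), of "Suc n" p]] assms(2)
    by simp
qed

section \<open>Diagonally dominant linear systems\<close>

text \<open>Gaussian elimination of one unknown per step. The pivot 1 - M z z is at least the
  absolute sum of the other entries of row z, so substitution adds at most |M a z| to row a and its
  absolute sum stays below 1.\<close>

lemma diagonally_dominant_solvable:
  fixes M :: "'a \<Rightarrow> 'a \<Rightarrow> real"
  assumes "finite I" "\<And>a. a \<in> I \<Longrightarrow> (\<Sum>b\<in>I. \<bar>M a b\<bar>) < 1"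
  shows "\<exists>x. \<forall>a\<in>I. x a = r a + (\<Sum>b\<in>I. M a b * x b)"
  using assms
proof (induction I arbitrary: M r rule: finite_induct)
  case (insert z I)
  define D where "D = 1 - M z z"
  have z: "\<bar>M z z\<bar> + (\<Sum>b\<in>I. \<bar>M z b\<bar>) < 1" using insert by force
  then have D: "D > 0" "(\<Sum>b\<in>I. \<bar>M z b\<bar>) \<le> D"
    using sum_nonneg[of I "\<lambda>b. \<bar>M z b\<bar>"] abs_ge_self[of "M z z"] unfolding D_def by linarith+
  have "(\<Sum>b\<in>I. \<bar>M a b + M a z * M z b / D\<bar>) < 1" if "a \<in> I" for a
  proof -
    have "(\<Sum>b\<in>I. \<bar>M a b + M a z * M z b / D\<bar>) \<le> (\<Sum>b\<in>I. \<bar>M a b\<bar> + \<bar>M a z\<bar> * \<bar>M z b\<bar> / D)"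
      using D(1) by (intro sum_mono) (simp add: abs_mult order_trans[OF abs_triangle_ineq])
    also have "\<dots> = (\<Sum>b\<in>I. \<bar>M a b\<bar>) + \<bar>M a z\<bar> * ((\<Sum>b\<in>I. \<bar>M z b\<bar>) / D)"
      by (simp add: sum.distrib sum_distrib_left sum_divide_distrib)
    also have "\<dots> \<le> (\<Sum>b\<in>I. \<bar>M a b\<bar>) + \<bar>M a z\<bar> * 1"
      using D by (intro add_left_mono mult_left_mono) auto
    also have "\<dots> < 1" using insert.prems[of a] insert.hyps that by auto
    finally show ?thesis .
  qed
  from insert.IH[of "\<lambda>a b. M a b + M a z * M z b / D", OF this, where r = "\<lambda>a. r a + M a z * r z / D"]
  obtain x where x: "\<And>a. a \<in> I \<Longrightarrow> x a = r a + M a z * r z / D + (\<Sum>b\<in>I. (M a b + M a z * M z b / D) * x b)"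
    by blast
  define xz where "xz = (r z + (\<Sum>b\<in>I. M z b * x b)) / D"
  have eqz: "xz = r z + M z z * xz + (\<Sum>b\<in>I. M z b * x b)"
    using D(1) by (simp add: xz_def D_def field_simps)
  have "x a = r a + M a z * xz + (\<Sum>b\<in>I. M a b * x b)" if "a \<in> I" for a
    using x[OF that] by (simp add: xz_def algebra_simps sum.distrib sum_distrib_left
        add_divide_distrib sum_divide_distrib)
  moreover have "(\<Sum>b\<in>I. M a b * (x(z := xz)) b) = (\<Sum>b\<in>I. M a b * x b)" for a
    using insert.hyps by (intro sum.cong) auto
  ultimately show ?case
    using insert.hyps eqz by (intro exI[of _ "x(z := xz)"]) auto
qed auto

section \<open>Smoothness of monomials\<close>

text \<open>Rephrased as a limit along a filter, continuity passes to products by the standard limit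
  rules.\<close>

lemma contV_iff_tendsto:
  "contV d g \<longleftrightarrow> (\<forall>x. inV d x \<longrightarrow>
     (g \<longlongrightarrow> g x) (inf (filtercomap (edist d x) (nhds 0)) (principal {y. inV d y})))"
proof -
  have ev: "eventually P (inf (filtercomap (edist d x) (nhds 0)) (principal {y. inV d y}))
    \<longleftrightarrow> (\<exists>\<delta>>0. \<forall>y. inV d y \<and> edist d x y < \<delta> \<longrightarrow> P y)" for P x
  proof -
    have "0 \<le> edist d x y" for y by (simp add: edist_def sum_nonneg)
    then show ?thesis
      by (auto simp: eventually_inf_principal eventually_filtercomap eventually_nhds_metric dist_real_def)
  qed
  show ?thesis by (simp add: contV_def tendsto_iff ev dist_real_def)
qed

lemma contV_coordinate:
  assumes "e < d" shows "contV d (\<lambda>x. x e)"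
  unfolding contV_def
proof (intro allI impI)
  fix x and \<epsilon> :: real assume "\<epsilon> > 0"
  have "\<bar>y e - x e\<bar> < \<epsilon>" if "edist d x y < \<epsilon>" for y
  proof -
    have "(x e - y e)\<^sup>2 \<le> (\<Sum>i<d. (x i - y i)\<^sup>2)"
      using assms by (intro member_le_sum) auto
    then have "\<bar>x e - y e\<bar> \<le> edist d x y"
      unfolding edist_def by (metis real_sqrt_abs real_sqrt_le_mono)
    then show ?thesis using that by linarith
  qed
  then show "\<exists>\<delta>>0. \<forall>y. inV d y \<and> edist d x y < \<delta> \<longrightarrow> \<bar>y e - x e\<bar> < \<epsilon>"
    using \<open>\<epsilon> > 0\<close> by blast
qed

lemma contV_monomial:
  "set w \<subseteq> {..<d} \<Longrightarrow> contV d (\<lambda>x. c * (\<Prod>e\<leftarrow>w. x e))"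
proof (induction w)
  case Nil
  show ?case unfolding contV_iff_tendsto by simp
next
  case (Cons e w)
  then have "contV d (\<lambda>x. c * (\<Prod>e\<leftarrow>w. x e))" "contV d (\<lambda>x. x e)"
    by (auto intro: contV_coordinate)
  then have "contV d (\<lambda>x. x e * (c * (\<Prod>e\<leftarrow>w. x e)))"
    unfolding contV_iff_tendsto by (auto intro: tendsto_mult)
  then show ?case by (simp add: mult_ac)
qed

text \<open>All occurrences of \<open>i\<close> contribute the same term, so one is removed and
  their number becomes a factor. If \<open>i\<close> is absent this factor is 0.\<close>

lemma DERIV_monomial:
  fixes x :: "nat \<Rightarrow> real"
  shows "((\<lambda>t. \<Prod>e\<leftarrow>w. (x(i := x i + t)) e) has_real_derivative
     real (count_list w i) * (\<Prod>e\<leftarrow>remove1 i w. x e)) (at 0)"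
proof (induction w)
  case (Cons a w)
  have 1: "((\<lambda>t. (x(i := x i + t)) a) has_real_derivative (if a = i then 1 else 0)) (at 0)"
    by (auto intro!: derivative_eq_intros)
  have "i \<in> set w \<Longrightarrow> x i * (\<Prod>e\<leftarrow>remove1 i w. x e) = (\<Prod>e\<leftarrow>w. x e)"
    by (induction w) auto
  moreover have "i \<notin> set w \<Longrightarrow> count_list w i = 0" by simp
  ultimately have 2: "real (count_list w i) * (x i * (\<Prod>e\<leftarrow>remove1 i w. x e)) = real (count_list w i) * (\<Prod>e\<leftarrow>w. x e)"
    by (cases "i \<in> set w") auto
  have "(if a = i then 1 else 0) * (\<Prod>e\<leftarrow>w. (x(i := x i + 0)) e)
        + real (count_list w i) * (\<Prod>e\<leftarrow>remove1 i w. x e) * (x(i := x i + 0)) a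
      = real (count_list (a # w) i) * (\<Prod>e\<leftarrow>remove1 i (a # w). x e)"
    using 2 by (auto simp: algebra_simps)
  then show ?case
    using DERIV_mult[OF 1 Cons] by simp
qed auto

text \<open>With the scalar \<open>c\<close> included, monomials are closed under partial
  derivatives, so the induction stays within the class.\<close>

lemma smooth_monomial:
  assumes "set w \<subseteq> {..<d}" shows "smooth_fun d (\<lambda>x. c * (\<Prod>e\<leftarrow>w. x e))"
  unfolding smooth_fun_def
proof
  fix n show "Ck d n (\<lambda>x. c * (\<Prod>e\<leftarrow>w. x e))"
    using assms
  proof (induction n arbitrary: c w)
    case 0
    then show ?case by (simp add: contV_monomial)
  next
    case (Suc n)
    have "Ck d n (\<lambda>x. c * real (count_list w i) * (\<Prod>e\<leftarrow>remove1 i w. x e))" for i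
      using Suc.prems set_remove1_subset[of i w] by (intro Suc.IH) blast
    moreover have "((\<lambda>t. c * (\<Prod>e\<leftarrow>w. (x(i := x i + t)) e)) has_real_derivative
       c * real (count_list w i) * (\<Prod>e\<leftarrow>remove1 i w. x e)) (at 0)" for i and x :: "nat \<Rightarrow> real"
      using DERIV_cmult[OF DERIV_monomial, of c] by (simp add: mult.assoc)
    ultimately show ?case
      unfolding Ck.simps by (intro conjI contV_monomial[OF Suc.prems] allI impI exI) assumption+
  qed
qed

section \<open>Integration of expansions\<close>

text \<open>By the mean value theorem f(t) = t g(z) for some z in (0, t), which gains the extra
  power of t without an integral.\<close>

lemma bigo_integrate:
  fixes f g :: "real \<Rightarrow> real"
  assumes T: "T > 0" and f0: "f 0 = 0"
    and f: "\<And>t. t \<in> {0..T} \<Longrightarrow> (f has_real_derivative g t) (at t within {0..T})"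
    and g: "g \<in> O[at_right 0](\<lambda>t. t ^ n)"
  shows "f \<in> O[at_right 0](\<lambda>t. t ^ Suc n)"
proof -
  obtain C where C: "C > 0" "\<forall>\<^sub>F t in at_right 0. norm (g t) \<le> C * norm (t ^ n)"
    using g by (elim landau_o.bigE)
  then obtain b where b: "b > 0" "\<And>t. 0 < t \<Longrightarrow> t < b \<Longrightarrow> \<bar>g t\<bar> \<le> C * t ^ n"
    by (auto simp: eventually_at_right_field)
  have bound: "\<bar>f t\<bar> \<le> C * t ^ Suc n" if t: "0 < t" "t < b" "t < T" for t
  proof -
    have "continuous_on {0..T} f"
      using f by (meson DERIV_continuous continuous_on_eq_continuous_within)
    then have "continuous_on {0..t} f"
      using t by (auto elim: continuous_on_subset)
    moreover have der: "(f has_real_derivative g x) (at x)" if "0 < x" "x < t" for x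
      using f[of x] that t by (simp add: at_within_Icc_at)
    ultimately obtain l z where z: "0 < z" "z < t" "(f has_real_derivative l) (at z)" "f t - f 0 = (t - 0) * l"
      using MVT[OF t(1), of f] by (metis real_differentiable_def)
    have "l = g z" using DERIV_unique[OF z(3) der[OF z(1,2)]] .
    then have "\<bar>f t\<bar> = t * \<bar>g z\<bar>" using z t f0 by (simp add: abs_mult)
    also have "\<dots> \<le> t * (C * z ^ n)" using b(2)[of z] z t by (intro mult_left_mono) auto
    also have "\<dots> \<le> t * (C * t ^ n)" using z t C(1) by (intro mult_left_mono power_mono) auto
    finally show ?thesis by (simp add: mult_ac)
  qed
  have "\<forall>\<^sub>F t in at_right 0. norm (f t) \<le> C * norm (t ^ Suc n)"
    unfolding eventually_at_right_field using bound b(1) T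
    by (intro exI[of _ "min b T"]) auto
  then show ?thesis by (rule bigoI)
qed

lemma expands_integrate:
  fixes f g :: "real \<Rightarrow> real"
  assumes T: "T > 0" and f0: "f 0 = 0"
    and f: "\<And>t. t \<in> {0..T} \<Longrightarrow> (f has_real_derivative g t) (at t within {0..T})"
    and g: "expands (at_right 0) (\<lambda>t. t) n g Z"
  shows "expands (at_right 0) (\<lambda>t. t) (Suc n) f (fps_integral0 Z)"
proof -
  have sum: "(\<Sum>j\<le>Suc n. fps_integral0 Z $ j * t ^ j) = (\<Sum>j\<le>n. Z $ j * (t ^ Suc j / real (Suc j)))" for t
    by (subst sum.atMost_Suc_shift) (simp add: field_simps del: of_nat_Suc)
  have "((\<lambda>t. \<Sum>j\<le>n. Z $ j * (t ^ Suc j / real (Suc j))) has_real_derivative (\<Sum>j\<le>n. Z $ j * t ^ j)) (at t within S)" for t S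
  proof (intro DERIV_sum DERIV_cmult)
    fix j show "((\<lambda>t. t ^ Suc j / real (Suc j)) has_real_derivative t ^ j) (at t within S)"
      using DERIV_cdivide[OF DERIV_pow[of "Suc j" t S], of "real (Suc j)"]
      by (simp del: of_nat_Suc power_Suc)
  qed
  then have "(\<lambda>t. f t - (\<Sum>j\<le>n. Z $ j * (t ^ Suc j / real (Suc j)))) \<in> O[at_right 0](\<lambda>t. t ^ Suc (Suc n))"
    using g f0 by (intro bigo_integrate[OF T _ DERIV_diff[OF f]]) (auto simp: expands_def)
  then show ?thesis by (simp add: expands_def sum del: sum.atMost_Suc)
qed

section \<open>The stage equations\<close>

locale gark_row_problem = gark_row +
  fixes d :: nat and F :: "nat \<Rightarrow> (nat \<Rightarrow> real) \<Rightarrow> nat \<Rightarrow> real" and L :: "nat \<Rightarrow> nat \<Rightarrow> nat \<Rightarrow> real"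
    and y0 :: "nat \<Rightarrow> real"
  assumes smooth: "\<And>m. m < N \<Longrightarrow> smooth_field d (F m)" and y0: "inV d y0"
    and alpha_zero: "\<And>q m i j. j \<ge> i \<Longrightarrow> alpha q m i j = 0"
    and gam_zero: "\<And>q m i j. j > i \<Longrightarrow> gam q m i j = 0"
begin

text \<open>The partitions owning a stage of index \<open>i\<close>. Their stages depend on each
  other through the diagonal of \<open>gam\<close> and must be solved as one block.\<close>

definition active :: "nat \<Rightarrow> nat set" where
  "active i = {q. q < N \<and> i < s q}"

lemma finite_active [simp]: "finite (active i)"
  by (simp add: active_def)

definition lower :: "(nat \<Rightarrow> nat \<Rightarrow> nat \<Rightarrow> nat \<Rightarrow> real) \<Rightarrow> (nat \<Rightarrow> nat \<Rightarrow> nat \<Rightarrow> real) \<Rightarrow> nat \<Rightarrow> nat \<Rightarrow> nat \<Rightarrow> real" where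
  "lower A k q i e = (\<Sum>m<N. \<Sum>j<s m. if j < i then A q m i j * k m j e else 0)"

lemma stage_arg_lower: "stage_arg N s alpha y0 k q i = (\<lambda>e. y0 e + lower alpha k q i e)"
  by (simp add: stage_arg_def lower_def)

lemma lower_cong:
  "(\<And>m j. m < N \<Longrightarrow> j < s m \<Longrightarrow> j < i \<Longrightarrow> k m j = k' m j) \<Longrightarrow> lower A k q i = lower A k' q i"
  unfolding lower_def by (intro ext sum.cong) auto

lemma coupling_split:
  "(\<Sum>m<N. \<Sum>j<s m. if j \<le> i then gam q m i j * k m j e else 0)
     = lower gam k q i e + (\<Sum>m\<in>active i. gam q m i i * k m i e)"
proof -
  have "(\<Sum>j<s m. if j \<le> i then gam q m i j * k m j e else 0)
      = (\<Sum>j<s m. if j < i then gam q m i j * k m j e else 0) + (if i < s m then gam q m i i * k m i e else 0)" for m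
  proof -
    have "(\<Sum>j<s m. if j \<le> i then gam q m i j * k m j e else 0)
      = (\<Sum>j<s m. (if j < i then gam q m i j * k m j e else 0) + (if j = i then gam q m i i * k m i e else 0))"
      by (intro sum.cong) auto
    then show ?thesis by (simp add: sum.distrib)
  qed
  moreover have "(\<Sum>m<N. if i < s m then gam q m i i * k m i e else 0) = (\<Sum>m\<in>active i. gam q m i i * k m i e)"
    by (simp add: active_def sum.If_cases lessThan_def Int_def)
  ultimately show ?thesis by (simp add: lower_def sum.distrib)
qed

definition stage_eq :: "real \<Rightarrow> (nat \<Rightarrow> nat \<Rightarrow> nat \<Rightarrow> real) \<Rightarrow> nat \<Rightarrow> nat \<Rightarrow> bool" where
  "stage_eq h k q i \<longleftrightarrow> inV d (k q i) \<and> (\<forall>c<d. k q i c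
     = h * F q (\<lambda>e. y0 e + lower alpha k q i e) c + h * (\<Sum>e<d. L q c e * lower gam k q i e)
       + (\<Sum>m\<in>active i. \<Sum>e<d. h * (L q c e * gam q m i i) * k m i e))"

lemma stage_sol_iff:
  "stage_sol d N s alpha gam F L y0 h k \<longleftrightarrow> (\<forall>q<N. \<forall>i<s q. stage_eq h k q i)"
proof -
  have "(\<Sum>e<d. L q c e * (\<Sum>m\<in>active i. gam q m i i * k m i e))
      = (\<Sum>m\<in>active i. \<Sum>e<d. L q c e * gam q m i i * k m i e)" for q c i
    by (subst sum.swap) (simp add: sum_distrib_left mult.assoc)
  then show ?thesis
    unfolding stage_sol_def stage_eq_def coupling_split stage_arg_lower
    by (simp add: distrib_left sum.distrib sum_distrib_left mult.assoc add.assoc)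
qed

text \<open>Induction on the stage index: with all earlier stages fixed, the block of index n is a
  linear system, since \<open>alpha\<close> is strictly lower triangular and the field sees only
  earlier stages.\<close>

lemma stages_exist_upto:
  "\<forall>\<^sub>F h in at_right 0. \<exists>k. \<forall>q<N. \<forall>i<s q. i < n \<longrightarrow> stage_eq h k q i"
proof (induction n)
  case (Suc n)
  define I where "I = active n \<times> {..<d}"
  have fin: "finite I" by (simp add: I_def)
  define M where "M = (\<lambda>(q, c) (m, e). L q c e * gam q m n n)"
  \<comment> \<open>The block matrix carries a factor h, so its absolute row sums tend to 0 and the
    system becomes uniquely pivotable by elimination.\<close>
  have "((\<lambda>h. \<Sum>b\<in>I. \<bar>h * M a b\<bar>) \<longlongrightarrow> (\<Sum>b\<in>I. \<bar>0 * M a b\<bar>)) (at_right 0)" for a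
    by (intro tendsto_intros)
  then have "\<forall>\<^sub>F h in at_right 0. (\<Sum>b\<in>I. \<bar>h * M a b\<bar>) < 1" for a
    by (rule order_tendstoD) simp
  then have "\<forall>\<^sub>F h in at_right 0. \<forall>a\<in>I. (\<Sum>b\<in>I. \<bar>h * M a b\<bar>) < 1"
    by (intro eventually_ball_finite fin) auto
  with Suc.IH show ?case
  proof eventually_elim
    case (elim h)
    then obtain k where k: "\<And>q i. q < N \<Longrightarrow> i < s q \<Longrightarrow> i < n \<Longrightarrow> stage_eq h k q i" by blast
    define r where "r = (\<lambda>(q, c). h * F q (\<lambda>e. y0 e + lower alpha k q n e) c + h * (\<Sum>e<d. L q c e * lower gam k q n e))"
    obtain x where x: "\<And>a. a \<in> I \<Longrightarrow> x a = r a + (\<Sum>b\<in>I. h * M a b * x b)"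
      using diagonally_dominant_solvable[of I "\<lambda>a b. h * M a b" r] elim(2) fin by blast
    define k' where "k' q j = (if j = n then (\<lambda>c. if c < d then x (q, c) else 0) else k q j)" for q j
    have low: "lower A k' q i = lower A k q i" if "i \<le> n" for A q i
      using that by (intro lower_cong) (auto simp: k'_def)
    have "stage_eq h k' q i" if q: "q < N" "i < s q" "i < Suc n" for q i
    proof (cases "i = n")
      case True
      show ?thesis unfolding stage_eq_def
      proof (intro conjI allI impI)
        show "inV d (k' q i)" using True by (simp add: k'_def inV_def)
        fix c assume c: "c < d"
        then have "x (q, c) = r (q, c) + (\<Sum>b\<in>I. h * M (q, c) b * x b)"
          using x[of "(q, c)"] q True by (simp add: I_def active_def)
        also have "(\<Sum>b\<in>I. h * M (q, c) b * x b) = (\<Sum>m\<in>active n. \<Sum>e<d. h * (L q c e * gam q m n n) * x (m, e))"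
          unfolding I_def M_def by (subst sum.cartesian_product) (simp add: split_def)
        finally show "k' q i c = h * F q (\<lambda>e. y0 e + lower alpha k' q i e) c + h * (\<Sum>e<d. L q c e * lower gam k' q i e)
            + (\<Sum>m\<in>active i. \<Sum>e<d. h * (L q c e * gam q m i i) * k' m i e)"
          using True c by (simp add: low r_def k'_def)
      qed
    next
      case False
      then have "stage_eq h k q i" using q by (intro k) auto
      then show ?thesis using q False unfolding stage_eq_def by (simp add: low) (simp add: k'_def)
    qed
    then show ?case by blast
  qed
qed auto

lemma stage_sol_exists: "\<forall>\<^sub>F h in at_right 0. \<exists>k. stage_sol d N s alpha gam F L y0 h k"
proof -
  have "s q \<le> (\<Sum>q<N. s q)" if "q < N" for q
    using that by (intro member_le_sum) auto
  then have *: "i < (\<Sum>q<N. s q)" if "q < N" "i < s q" for q i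
    using that by (meson order_less_le_trans)
  show ?thesis
    using stages_exist_upto[of "\<Sum>q<N. s q"]
  proof eventually_elim
    case (elim h)
    then show ?case unfolding stage_sol_iff using * by blast
  qed
qed

text \<open>The word approximation of order 0 has no words, so its remainder bound is local
  boundedness of the field.\<close>

lemma field_bigo_1:
  assumes "q < N" "c < d" "(h \<longlongrightarrow> 0) G" "\<And>e. e < d \<Longrightarrow> (\<lambda>x. u x e) \<in> O[G](h)" "\<forall>\<^sub>F x in G. inV d (u x)"
  shows "(\<lambda>x. F q (\<lambda>e. y0 e + u x e) c) \<in> O[G](\<lambda>_. 1)"
proof -
  have "Ck d 0 (\<lambda>x. F q x c)" using smooth[OF assms(1)] assms(2) unfolding smooth_field_def smooth_fun_def by blast
  then obtain a where "word_approx d y0 0 (\<lambda>x. F q x c) a" using word_taylor y0 by blast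
  from word_approx_bigo[OF this assms(3-5)] show ?thesis by simp
qed

section \<open>A priori bounds and expansions of the stages\<close>

lemma lower_inV:
  assumes "\<And>m j. m < N \<Longrightarrow> j < s m \<Longrightarrow> inV d (k m j)" shows "inV d (lower A k q i)"
  using assms by (auto simp: inV_def lower_def intro!: sum.neutral)

text \<open>An a priori estimate for every solution of the stage equations. By induction on the
  stage index the earlier stages are O(h); the implicit block satisfies W <= |h| R + |h| B W, and
  the last term is absorbed for small h.\<close>

lemma stages_bigo:
  assumes h: "(h \<longlongrightarrow> 0) G" and k: "\<forall>\<^sub>F x in G. stage_sol d N s alpha gam F L y0 (h x) (k x)"
    and "q < N" "i < s q" "c < d"
  shows "(\<lambda>x. k x q i c) \<in> O[G](h)"
  using assms(3-5)
proof (induction i arbitrary: q c rule: less_induct)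
  case (less i)
  have low: "(\<lambda>x. lower A (k x) q i e) \<in> O[G](h)" if "e < d" for A q e
    unfolding lower_def
  proof (intro big_sum_in_bigo)
    fix m j assume "m \<in> {..<N}" "j \<in> {..<s m}"
    then show "(\<lambda>x. if j < i then A q m i j * k x m j e else 0) \<in> O[G](h)"
      using less.IH[of j m e] that by (cases "j < i") auto
  qed
  have h1: "h \<in> O[G](\<lambda>_. 1)" using power_bigo_power[OF h, of 0 1] by simp
  have inV: "\<forall>\<^sub>F x in G. inV d (lower alpha (k x) q i)" for q
    using k by eventually_elim (auto simp: stage_sol_def intro: lower_inV)
  define r where "r q c x = F q (\<lambda>e. y0 e + lower alpha (k x) q i e) c + (\<Sum>e<d. L q c e * lower gam (k x) q i e)" for q c x
  have r: "r q c \<in> O[G](\<lambda>_. 1)" if "q < N" "c < d" for q c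
  proof -
    have "(\<lambda>x. \<Sum>e<d. L q c e * lower gam (k x) q i e) \<in> O[G](\<lambda>_. 1)"
      by (intro big_sum_in_bigo) (use landau_o.big_trans[OF low h1] in auto)
    moreover have "(\<lambda>x. F q (\<lambda>e. y0 e + lower alpha (k x) q i e) c) \<in> O[G](\<lambda>_. 1)"
      using that low by (intro field_bigo_1[OF _ _ h _ inV]) auto
    ultimately show ?thesis
      unfolding r_def by (intro sum_in_bigo(1))
  qed
  define I where "I = active i \<times> {..<d}"
  define W where "W x = (\<Sum>(q, c)\<in>I. \<bar>k x q i c\<bar>)" for x
  define R where "R x = (\<Sum>(q, c)\<in>I. \<bar>r q c x\<bar>)" for x
  define B where "B = (\<Sum>(q, c)\<in>I. \<Sum>(m, e)\<in>I. \<bar>L q c e * gam q m i i\<bar>)"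
  have fin: "finite I" by (simp add: I_def)
  have W0: "0 \<le> W x" for x by (auto simp: W_def intro!: sum_nonneg)
  have kW: "\<bar>k x q i c\<bar> \<le> W x" if "(q, c) \<in> I" for q c x
    using member_le_sum[of "(q, c)" I "\<lambda>(q, c). \<bar>k x q i c\<bar>"] that fin by (auto simp: W_def)
  have R: "R \<in> O[G](\<lambda>_. 1)"
    unfolding R_def split_def by (intro big_sum_in_bigo) (use r in \<open>auto simp: I_def active_def\<close>)
  have "\<forall>\<^sub>F x in G. W x \<le> \<bar>h x\<bar> * R x + \<bar>h x\<bar> * B * W x"
    using k
  proof eventually_elim
    case (elim x)
    have "\<bar>k x q i c\<bar> \<le> \<bar>h x\<bar> * \<bar>r q c x\<bar> + \<bar>h x\<bar> * (\<Sum>(m, e)\<in>I. \<bar>L q c e * gam q m i i\<bar>) * W x"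
      if qc: "(q, c) \<in> I" for q c
    proof -
      have "stage_eq (h x) (k x) q i" using elim qc by (auto simp: stage_sol_iff I_def active_def)
      then have "k x q i c = h x * r q c x + (\<Sum>(m, e)\<in>I. h x * (L q c e * gam q m i i) * k x m i e)"
        using qc by (simp add: stage_eq_def r_def distrib_left I_def sum.cartesian_product)
      also have "\<bar>\<dots>\<bar> \<le> \<bar>h x\<bar> * \<bar>r q c x\<bar> + (\<Sum>(m, e)\<in>I. \<bar>h x\<bar> * \<bar>L q c e * gam q m i i\<bar> * W x)"
      proof (rule order_trans[OF abs_triangle_ineq], rule add_mono)
        show "\<bar>\<Sum>(m, e)\<in>I. h x * (L q c e * gam q m i i) * k x m i e\<bar> \<le> (\<Sum>(m, e)\<in>I. \<bar>h x\<bar> * \<bar>L q c e * gam q m i i\<bar> * W x)"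
        proof (rule order_trans[OF sum_abs], rule sum_mono)
          fix b assume "b \<in> I"
          then show "\<bar>case b of (m, e) \<Rightarrow> h x * (L q c e * gam q m i i) * k x m i e\<bar>
             \<le> (case b of (m, e) \<Rightarrow> \<bar>h x\<bar> * \<bar>L q c e * gam q m i i\<bar> * W x)"
            using kW[of "fst b" "snd b" x]
            by (cases b) (simp only: prod.case abs_mult fst_conv snd_conv, intro mult_left_mono, auto)
        qed
      qed (simp add: abs_mult)
      finally show ?thesis by (simp add: split_def sum_distrib_left sum_distrib_right)
    qed
    then have "W x \<le> (\<Sum>(q, c)\<in>I. \<bar>h x\<bar> * \<bar>r q c x\<bar> + \<bar>h x\<bar> * (\<Sum>(m, e)\<in>I. \<bar>L q c e * gam q m i i\<bar>) * W x)"
      unfolding W_def[of x] by (intro sum_mono) (auto simp: W_def[symmetric])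
    then show ?case
      by (simp add: R_def B_def split_def sum.distrib sum_distrib_left sum_distrib_right)
  qed
  moreover have "\<forall>\<^sub>F x in G. \<bar>h x\<bar> * B < 1 / 2"
  proof -
    have "((\<lambda>x. \<bar>h x\<bar> * B) \<longlongrightarrow> \<bar>0\<bar> * B) G" by (intro tendsto_intros h)
    then show ?thesis by (rule order_tendstoD) simp
  qed
  ultimately have "\<forall>\<^sub>F x in G. norm (k x q i c) \<le> 2 * norm (h x * R x)"
  proof eventually_elim
    case (elim x)
    have "\<bar>h x\<bar> * B * W x \<le> 1 / 2 * W x" using elim(2) W0 by (intro mult_right_mono) auto
    then have "W x \<le> 2 * (\<bar>h x\<bar> * R x)" using elim(1) by linarith
    moreover have "\<bar>k x q i c\<bar> \<le> W x" using less.prems by (intro kW) (auto simp: I_def active_def)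
    moreover have "0 \<le> R x" by (auto simp: R_def intro!: sum_nonneg)
    ultimately show ?case by (simp add: abs_mult)
  qed
  then have "(\<lambda>x. k x q i c) \<in> O[G](\<lambda>x. h x * R x)" by (rule bigoI)
  also have "(\<lambda>x. h x * R x) \<in> O[G](\<lambda>x. h x * 1)"
    by (intro landau_o.big.mult R) auto
  finally show ?case by simp
qed

lemma stages_expand_step:
  assumes h: "(h \<longlongrightarrow> 0) G" and k: "\<forall>\<^sub>F x in G. stage_sol d N s alpha gam F L y0 (h x) (k x)"
    and a: "word_approx d y0 p (\<lambda>x. F q x c) a" and "n < p" "q < N" "i < s q" "c < d"
    and Z: "\<And>m j e. m < N \<Longrightarrow> j < s m \<Longrightarrow> e < d \<Longrightarrow> expands G h n (\<lambda>x. k x m j e) (Z e (Some (m, j)))"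
  shows "expands G h (Suc n) (\<lambda>x. k x q i c) (fps_X *
    ((\<Sum>w\<in>words d p. fps_const (a w) * (\<Prod>e\<leftarrow>w. fps_mix alpha q i (Z e)))
     + (\<Sum>e<d. fps_const (L q c e) * fps_mix gam q i (Z e))))"
proof -
  have mix: "expands G h n (\<lambda>x. mix A q i (\<lambda>y. case y of Some (m, j) \<Rightarrow> k x m j e | None \<Rightarrow> 0)) (fps_mix A q i (Z e))"
    if "e < d" for A e
    unfolding mix_def fps_mix_def using that by (auto intro!: expands_sum expands_scale Z)
  have low: "lower alpha (k x) q i e = mix alpha q i (\<lambda>y. case y of Some (m, j) \<Rightarrow> k x m j e | None \<Rightarrow> 0)" for x e
    unfolding lower_def mix_def by (intro sum.cong) (auto simp: alpha_zero)
  have low_bigo: "(\<lambda>x. lower alpha (k x) q i e) \<in> O[G](h)" if "e < d" for e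
    unfolding lower_def
  proof (intro big_sum_in_bigo)
    fix m j assume "m \<in> {..<N}" "j \<in> {..<s m}"
    then show "(\<lambda>x. if j < i then alpha q m i j * k x m j e else 0) \<in> O[G](h)"
      using stages_bigo[OF h k, of m j e] that by (cases "j < i") auto
  qed
  have inV: "\<forall>\<^sub>F x in G. inV d (lower alpha (k x) q i)"
    using k by eventually_elim (auto simp: stage_sol_def intro: lower_inV)
  have "expands G h n (\<lambda>x. F q (\<lambda>e. y0 e + lower alpha (k x) q i e) c)
    (\<Sum>w\<in>words d p. fps_const (a w) * (\<Prod>e\<leftarrow>w. fps_mix alpha q i (Z e)))"
    by (rule word_approx_expands[OF a \<open>n < p\<close> h low_bigo inV]) (use mix in \<open>auto simp: low\<close>)
  then have *: "expands G h (Suc n) (\<lambda>x. h x * (F q (\<lambda>e. y0 e + lower alpha (k x) q i e) c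
      + (\<Sum>e<d. L q c e * mix gam q i (\<lambda>y. case y of Some (m, j) \<Rightarrow> k x m j e | None \<Rightarrow> 0))))
    (fps_X * ((\<Sum>w\<in>words d p. fps_const (a w) * (\<Prod>e\<leftarrow>w. fps_mix alpha q i (Z e)))
     + (\<Sum>e<d. fps_const (L q c e) * fps_mix gam q i (Z e))))"
    by (intro expands_step_mult expands_add expands_sum expands_scale mix) auto
  have gam: "(\<Sum>m<N. \<Sum>j<s m. if j \<le> i then gam q m i j * k x m j e else 0)
      = mix gam q i (\<lambda>y. case y of Some (m, j) \<Rightarrow> k x m j e | None \<Rightarrow> 0)" for x e
    unfolding mix_def by (intro sum.cong) (auto simp: gam_zero)
  have "\<forall>\<^sub>F x in G. k x q i c = h x * (F q (\<lambda>e. y0 e + lower alpha (k x) q i e) c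
      + (\<Sum>e<d. L q c e * mix gam q i (\<lambda>y. case y of Some (m, j) \<Rightarrow> k x m j e | None \<Rightarrow> 0)))"
    using k
  proof eventually_elim
    case (elim x)
    then have "k x q i c = h x * F q (stage_arg N s alpha y0 (k x) q i) c
            + h x * (\<Sum>e<d. L q c e * (\<Sum>m<N. \<Sum>j<s m. if j \<le> i then gam q m i j * k x m j e else 0))"
      unfolding stage_sol_def using assms by blast
    then show ?case by (simp only: stage_arg_lower gam distrib_left)
  qed
  then have "(\<lambda>x. k x q i c - h x * (F q (\<lambda>e. y0 e + lower alpha (k x) q i e) c
      + (\<Sum>e<d. L q c e * mix gam q i (\<lambda>y. case y of Some (m, j) \<Rightarrow> k x m j e | None \<Rightarrow> 0)))) \<in> O[G](\<lambda>x. h x ^ Suc (Suc n))"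
    \<comment> \<open>The two sides agree eventually, so the constant 0 suffices.\<close>
    by (intro bigoI[of _ 0]) (auto elim: eventually_mono)
  with * show ?thesis by (rule expands_perturb)
qed

end

section \<open>Sufficiency of the tree conditions\<close>

context gark_row_problem
begin

section \<open>Joint expansion of the exact and the numerical solution in tree vectors\<close>

context
  fixes T :: real and y :: "real \<Rightarrow> nat \<Rightarrow> real"
  assumes T: "T > 0" and sol: "exact_sol d N F y0 T y"
begin

text \<open>The solution is written as \<open>y0\<close> plus displacement because word
  approximations are stated in that form.\<close>

lemma increment_deriv:
  assumes "c < d" "t \<in> {0..T}"
  shows "((\<lambda>t. y t c - y0 c) has_real_derivative (\<Sum>m<N. F m (\<lambda>e. y0 e + (y t e - y0 e)) c)) (at t within {0..T})"
proof -
  have "((\<lambda>\<tau>. y \<tau> c) has_real_derivative (\<Sum>m<N. F m (y t) c)) (at t within {0..T})"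
    using sol assms unfolding exact_sol_def by blast
  from DERIV_diff[OF this DERIV_const] show ?thesis by simp
qed

lemma increment_0: "y 0 c - y0 c = 0"
  using sol by (simp add: exact_sol_def)

lemma increment_inV: "\<forall>\<^sub>F t in at_right 0. inV d (\<lambda>e. y t e - y0 e)"
proof -
  have "inV d (\<lambda>e. y t e - y0 e)" if "t \<in> {0..T}" for t
    using sol that y0 by (auto simp: exact_sol_def inV_def)
  then show ?thesis
    unfolding eventually_at_right_field by (intro exI[of _ T]) (use T in auto)
qed

lemma increment_bigo:
  assumes "c < d" shows "(\<lambda>t. y t c - y0 c) \<in> O[at_right 0](\<lambda>t. t)"
proof -
  \<comment> \<open>Boundedness of the field needs a gauge that tends to 0 and dominates the
    displacement, before the rate t is known. The total displacement itself is such a gauge, by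
    continuity; integrating the bounded derivative then gives O(t).\<close>
  define h where "h t = (\<Sum>e<d. \<bar>y t e - y0 e\<bar>)" for t
  have "((\<lambda>t. y t e - y0 e) \<longlongrightarrow> 0) (at_right 0)" if "e < d" for e
  proof -
    have "((\<lambda>t. y t e - y0 e) \<longlongrightarrow> y 0 e - y0 e) (at 0 within {0..T})"
      using DERIV_continuous[OF increment_deriv[OF that, of 0]] T by (simp add: continuous_within)
    then show ?thesis using T by (simp only: at_within_Icc_at_right increment_0)
  qed
  then have "(h \<longlongrightarrow> (\<Sum>e<d. \<bar>0\<bar>)) (at_right 0)"
    unfolding h_def by (intro tendsto_sum tendsto_rabs) auto
  then have h: "(h \<longlongrightarrow> 0) (at_right 0)" by simp
  have "(\<lambda>t. y t e - y0 e) \<in> O[at_right 0](h)" if "e < d" for e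
  proof (rule bigoI[of _ 1], rule always_eventually, rule allI)
    fix t
    have "\<bar>y t e - y0 e\<bar> \<le> h t" unfolding h_def using that by (intro member_le_sum) auto
    then show "norm (y t e - y0 e) \<le> 1 * norm (h t)" by simp
  qed
  then have "(\<lambda>t. \<Sum>m<N. F m (\<lambda>e. y0 e + (y t e - y0 e)) c) \<in> O[at_right 0](\<lambda>_. 1)"
    using assms by (intro big_sum_in_bigo field_bigo_1[OF _ _ h _ increment_inV]) auto
  then show ?thesis
    using bigo_integrate[OF T increment_0 increment_deriv[OF assms], where n = 0] by simp
qed

lemma increment_expand_step:
  assumes a: "\<And>m. m < N \<Longrightarrow> word_approx d y0 p (\<lambda>x. F m x c) (a m)" and "n < p" "c < d"
    and Z: "\<And>e. e < d \<Longrightarrow> expands (at_right 0) (\<lambda>t. t) n (\<lambda>t. y t e - y0 e) (Z e)"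
  shows "expands (at_right 0) (\<lambda>t. t) (Suc n) (\<lambda>t. y t c - y0 c)
    (fps_integral0 (\<Sum>m<N. \<Sum>w\<in>words d p. fps_const (a m w) * (\<Prod>e\<leftarrow>w. Z e)))"
proof (rule expands_integrate[OF T increment_0 increment_deriv[OF \<open>c < d\<close>]])
  show "expands (at_right 0) (\<lambda>t. t) n (\<lambda>t. \<Sum>m<N. F m (\<lambda>e. y0 e + (y t e - y0 e)) c)
    (\<Sum>m<N. \<Sum>w\<in>words d p. fps_const (a m w) * (\<Prod>e\<leftarrow>w. Z e))"
  proof (rule expands_sum)
    fix m assume "m \<in> {..<N}"
    then show "expands (at_right 0) (\<lambda>t. t) n (\<lambda>t. F m (\<lambda>e. y0 e + (y t e - y0 e)) c)
      (\<Sum>w\<in>words d p. fps_const (a m w) * (\<Prod>e\<leftarrow>w. Z e))"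
      using increment_bigo Z
      by (intro word_approx_expands[OF a \<open>n < p\<close> _ _ increment_inV]) (auto intro: tendsto_ident_at)
  qed
qed auto

text \<open>Induction on the expansion order \<open>n\<close>, with the Taylor order
  \<open>p\<close> fixed throughout. Coefficients above \<open>n\<close> are left unconstrained,
  since truncated expansions do not see them.\<close>

lemma tree_expansion:
  assumes h: "(h \<longlongrightarrow> 0) G" and k: "\<forall>\<^sub>F x in G. stage_sol d N s alpha gam F L y0 (h x) (k x)"
    and "n \<le> p"
  shows "\<exists>v. (\<forall>c<d. \<forall>j\<le>n. (\<lambda>x. v c x $ j) \<in> tree_span j)
    \<and> (\<forall>c<d. expands (at_right 0) (\<lambda>t. t) n (\<lambda>t. y t c - y0 c) (v c None))
    \<and> (\<forall>c<d. \<forall>q<N. \<forall>i<s q. expands G h n (\<lambda>x. k x q i c) (v c (Some (q, i))))"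
  using assms(3)
proof (induction n)
  case 0
  have "expands (at_right 0) (\<lambda>t. t) 0 (\<lambda>t. y t c - y0 c) 0" if "c < d" for c
    using increment_bigo[OF that] by (simp add: expands_def)
  moreover have "expands G h 0 (\<lambda>x. k x q i c) 0" if "c < d" "q < N" "i < s q" for c q i
    using stages_bigo[OF h k, of q i c] that by (simp add: expands_def)
  ultimately show ?case
    by (intro exI[of _ "\<lambda>_ _. 0"]) (auto intro: tree_span.zero)
next
  case (Suc n)
  from Suc.IH[OF Suc_leD[OF Suc.prems]]
  obtain v where span: "\<And>c j. c < d \<Longrightarrow> j \<le> n \<Longrightarrow> (\<lambda>x. v c x $ j) \<in> tree_span j"
    and exact: "\<And>c. c < d \<Longrightarrow> expands (at_right 0) (\<lambda>t. t) n (\<lambda>t. y t c - y0 c) (v c None)"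
    and stages: "\<And>c q i. c < d \<Longrightarrow> q < N \<Longrightarrow> i < s q \<Longrightarrow> expands G h n (\<lambda>x. k x q i c) (v c (Some (q, i)))"
    by blast
  have "\<exists>a. word_approx d y0 p (\<lambda>x. F q x c) a" if "q < N" "c < d" for q c
    using smooth[OF that(1)] that(2) y0 unfolding smooth_field_def smooth_fun_def
    by (intro word_taylor) auto
  then obtain a where a: "\<And>q c. q < N \<Longrightarrow> c < d \<Longrightarrow> word_approx d y0 p (\<lambda>x. F q x c) (a q c)"
    by metis
  \<comment> \<open>The right-hand sides of the integrated differential equation and of the stage
    equations, read as power series. The value 0 for colours outside the range matches the grafts,
    which are summed over q < N only.\<close>
  define v' where "v' c x = (case x of
       None \<Rightarrow> fps_integral0 (\<Sum>q<N. \<Sum>w\<in>words d p. fps_const (a q c w) * (\<Prod>e\<leftarrow>w. v e None))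
     | Some (q, i) \<Rightarrow> if q < N then fps_X *
         ((\<Sum>w\<in>words d p. fps_const (a q c w) * (\<Prod>e\<leftarrow>w. fps_mix alpha q i (v e)))
          + (\<Sum>e<d. fps_const (L q c e) * fps_mix gam q i (v e))) else 0)" for c x
  have "(\<lambda>x. v' c x $ j) \<in> tree_span j" if c: "c < d" and j: "j \<le> Suc n" for c j
  proof (cases j)
    case 0
    then have "(\<lambda>x. v' c x $ j) = (\<lambda>_. 0)"
      by (auto simp: v'_def fun_eq_iff split: option.splits)
    then show ?thesis by (simp add: tree_span.zero)
  next
    case (Suc j')
    \<comment> \<open>Here the two recursions merge: the scalars \<open>a q c w\<close> and
      \<open>L q c e\<close> do not depend on the slot \<open>x\<close>, so the coefficient is a
      combination of grafts of whole joint vectors. In the slot \<open>None\<close>, division by j'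
      + 1 is the integral.\<close>
    have "(\<lambda>x. v' c x $ j) = (\<lambda>x. (\<Sum>q<N. \<Sum>w\<in>words d p. a q c w * graft_round q [] (map v w) j' x)
        + 1 * (\<Sum>q<N. \<Sum>e<d. L q c e * graft_square q (\<lambda>x. v e x $ j') x))"
    proof
      fix x show "v' c x $ j = (\<Sum>q<N. \<Sum>w\<in>words d p. a q c w * graft_round q [] (map v w) j' x)
        + 1 * (\<Sum>q<N. \<Sum>e<d. L q c e * graft_square q (\<lambda>x. v e x $ j') x)"
      proof (cases x)
        case None
        then show ?thesis using Suc
          by (simp add: v'_def graft_round_def graft_square_def fps_sum_nth o_def
              sum_distrib_left divide_inverse mult_ac)
      next
        case (Some qi)
        obtain q i where qi: "qi = (q, i)" by fastforce
        have 1: "(\<Sum>w\<in>words d p. a m c w * graft_round m [] (map v w) j' x)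
           = (if m = q then \<Sum>w\<in>words d p. a q c w * (\<Prod>e\<leftarrow>w. fps_mix alpha q i (v e)) $ j' else 0)" for m
          using Some qi by (auto simp: graft_round_def o_def)
        have 2: "(\<Sum>e<d. L m c e * graft_square m (\<lambda>x. v e x $ j') x)
           = (if m = q then \<Sum>e<d. L q c e * mix gam q i (\<lambda>x. v e x $ j') else 0)" for m
          using Some qi by (auto simp: graft_square_def)
        show ?thesis unfolding 1 2 using Some qi Suc
          by (auto simp: v'_def fps_sum_nth fps_mix_nth)
      qed
    qed
    also have "\<dots> \<in> tree_span j"
      unfolding Suc using span j Suc
      by (intro tree_span_add_scaled tree_span_sum tree_span_scale graft_square_in_span
          graft_round_in_span[of _ "[]", simplified]) (auto simp: words_def)
    finally show ?thesis .
  qed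
  moreover have "expands (at_right 0) (\<lambda>t. t) (Suc n) (\<lambda>t. y t c - y0 c) (v' c None)" if "c < d" for c
    unfolding v'_def option.case using that a exact Suc.prems by (intro increment_expand_step) auto
  moreover have "expands G h (Suc n) (\<lambda>x. k x q i c) (v' c (Some (q, i)))"
    if "c < d" "q < N" "i < s q" for c q i
    using stages Suc.prems that by (auto simp: v'_def intro!: stages_expand_step[OF h k a])
  ultimately show ?case by blast
qed

lemma local_error:
  assumes order: "\<And>t. wf_tw N t \<Longrightarrow> rho t \<le> p \<Longrightarrow>
       phi N s b alpha gam t = (if round_only t then 1 / real (dens t) else 0)"
    and h: "filterlim h (at_right 0) G"
    and k: "\<forall>\<^sub>F x in G. stage_sol d N s alpha gam F L y0 (h x) (k x)" and c: "c < d"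
  shows "(\<lambda>x. num_sol N s b y0 (k x) c - y (h x) c) \<in> O[G](\<lambda>x. h x ^ Suc p)"
proof -
  have h0: "(h \<longlongrightarrow> 0) G" using h by (simp add: filterlim_at)
  obtain v where span: "\<And>c j. c < d \<Longrightarrow> j \<le> p \<Longrightarrow> (\<lambda>x. v c x $ j) \<in> tree_span j"
    and exact: "\<And>c. c < d \<Longrightarrow> expands (at_right 0) (\<lambda>t. t) p (\<lambda>t. y t c - y0 c) (v c None)"
    and stages: "\<And>c q i. c < d \<Longrightarrow> q < N \<Longrightarrow> i < s q \<Longrightarrow> expands G h p (\<lambda>x. k x q i c) (v c (Some (q, i)))"
    using tree_expansion[OF h0 k order_refl[of p]] by blast
  have "expands G h p (\<lambda>x. y (h x) c - y0 c) (v c None)"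
    using expands_compose[OF exact[OF c] h] .
  moreover have "expands G h p (\<lambda>x. \<Sum>q<N. \<Sum>i<s q. b q i * k x q i c)
      (\<Sum>q<N. \<Sum>i<s q. fps_const (b q i) * v c (Some (q, i)))"
    by (intro expands_sum expands_scale stages c) auto
  ultimately have "expands G h p (\<lambda>x. (\<Sum>q<N. \<Sum>i<s q. b q i * k x q i c) + (-1) * (y (h x) c - y0 c))
      ((\<Sum>q<N. \<Sum>i<s q. fps_const (b q i) * v c (Some (q, i))) + fps_const (-1) * v c None)" (is "expands G h p ?f ?Z")
    by (intro expands_add expands_scale)
  moreover have "?Z $ j = 0" if "j \<le> p" for j
  proof -
    have "(\<Sum>q<N. \<Sum>i<s q. b q i * w (Some (q, i))) = w None" if "w \<in> tree_span j" for w
      using that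
    proof induction
      case (add_tree w t r)
      have "(\<Sum>q<N. \<Sum>i<s q. b q i * tree_vec t (Some (q, i))) = tree_vec t None"
        using order[of t] add_tree \<open>j \<le> p\<close> by (simp add: tree_vec_def phi_def)
      moreover have "(\<Sum>q<N. \<Sum>i<s q. b q i * (w (Some (q, i)) + r * tree_vec t (Some (q, i))))
          = (\<Sum>q<N. \<Sum>i<s q. b q i * w (Some (q, i))) + r * (\<Sum>q<N. \<Sum>i<s q. b q i * tree_vec t (Some (q, i)))"
        by (simp add: sum.distrib sum_distrib_left algebra_simps)
      ultimately show ?case using add_tree by simp
    qed auto
    from this[OF span[OF c that]] show ?thesis
      by (simp add: fps_sum_nth)
  qed
  ultimately have "?f \<in> O[G](\<lambda>x. h x ^ Suc p)" unfolding expands_def by simp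
  then show ?thesis by (simp add: num_sol_def algebra_simps)
qed

end

end

lemma tree_conditions_imp_order:
  assumes "\<And>q m i j. j \<ge> i \<Longrightarrow> alpha q m i j = 0" "\<And>q m i j. j > i \<Longrightarrow> gam q m i j = 0"
    and order: "\<And>t. wf_tw N t \<Longrightarrow> rho t \<le> p \<Longrightarrow>
       phi N s b alpha gam t = (if round_only t then 1 / real (dens t) else 0)"
  shows "gark_row_order N s b alpha gam p"
  unfolding gark_row_order_def
proof (intro allI impI)
  fix d F L y0 T y
  assume F: "\<forall>m<N. smooth_field d (F m)" and y0: "inV d y0" and T: "T > 0" and sol: "exact_sol d N F y0 T y"
  interpret gark_row_problem N s alpha gam d F L y0
    using F y0 assms by unfold_locales auto
  \<comment> \<open>Working over pairs of a step size and a solution of its stage equations makes the bound uniform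
    in the stage solutions without proving them unique.\<close>
  define S where "S = {(h, k). stage_sol d N s alpha gam F L y0 h k}"
  define G where "G = inf (filtercomap fst (at_right (0::real))) (principal S)"
  have "\<exists>C. \<forall>\<^sub>F x in G. \<forall>c<d. \<bar>num_sol N s b y0 (snd x) c - y (fst x) c\<bar> \<le> C * \<bar>fst x ^ Suc p\<bar>"
  proof -
    have lim: "filterlim fst (at_right 0) G"
      unfolding G_def by (rule filterlim_mono[OF filterlim_filtercomap order_refl inf_le1])
    have "\<forall>\<^sub>F x in G. x \<in> S"
      by (simp add: G_def eventually_inf_principal)
    then have "\<forall>\<^sub>F x in G. stage_sol d N s alpha gam F L y0 (fst x) (snd x)"
      by eventually_elim (auto simp: S_def)
    then have "(\<lambda>x. num_sol N s b y0 (snd x) c - y (fst x) c) \<in> O[G](\<lambda>x. fst x ^ Suc p)" if "c < d" for c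
      using local_error[OF T sol order lim] that by blast
    \<comment> \<open>Summing over the coordinates yields one constant valid for all of
      them.\<close>
    then have "(\<lambda>x. \<Sum>c<d. \<bar>num_sol N s b y0 (snd x) c - y (fst x) c\<bar>) \<in> O[G](\<lambda>x. fst x ^ Suc p)"
      by (intro big_sum_in_bigo) auto
    then obtain C where "\<forall>\<^sub>F x in G. norm (\<Sum>c<d. \<bar>num_sol N s b y0 (snd x) c - y (fst x) c\<bar>) \<le> C * norm (fst x ^ Suc p)"
      by (elim landau_o.bigE)
    then have "\<forall>\<^sub>F x in G. \<forall>c<d. \<bar>num_sol N s b y0 (snd x) c - y (fst x) c\<bar> \<le> C * \<bar>fst x ^ Suc p\<bar>"
    proof eventually_elim
      case (elim x)
      have "\<bar>num_sol N s b y0 (snd x) c - y (fst x) c\<bar> \<le> (\<Sum>c<d. \<bar>num_sol N s b y0 (snd x) c - y (fst x) c\<bar>)" if "c < d" for c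
        using that by (intro member_le_sum) auto
      then show ?case using elim by fastforce
    qed
    then show ?thesis ..
  qed
  then obtain C where "\<forall>\<^sub>F x in G. \<forall>c<d. \<bar>num_sol N s b y0 (snd x) c - y (fst x) c\<bar> \<le> C * \<bar>fst x ^ Suc p\<bar>" ..
  then have "\<forall>\<^sub>F h in at_right 0. \<forall>k. stage_sol d N s alpha gam F L y0 h k \<longrightarrow>
      (\<forall>c<d. \<bar>num_sol N s b y0 k c - y h c\<bar> \<le> C * \<bar>h ^ Suc p\<bar>)"
    unfolding G_def eventually_inf_principal eventually_filtercomap
    by (auto simp: S_def elim!: eventually_mono)
  from eventually_conj[OF stage_sol_exists this] obtain \<delta> where "\<delta> > 0" "\<And>h. 0 < h \<Longrightarrow> h < \<delta> \<Longrightarrow> (\<exists>k. stage_sol d N s alpha gam F L y0 h k)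
      \<and> (\<forall>k. stage_sol d N s alpha gam F L y0 h k \<longrightarrow> (\<forall>c<d. \<bar>num_sol N s b y0 k c - y h c\<bar> \<le> C * \<bar>h ^ Suc p\<bar>))"
    unfolding eventually_at_right_field by auto
  then show "\<exists>\<delta>>0. \<exists>C. \<forall>h. 0 < h \<and> h < \<delta> \<longrightarrow>
           (\<exists>k. stage_sol d N s alpha gam F L y0 h k) \<and>
           (\<forall>k. stage_sol d N s alpha gam F L y0 h k \<longrightarrow>
              (\<forall>c<d. \<bar>num_sol N s b y0 k c - y h c\<bar> \<le> C * h ^ (p + 1)))"
    by (intro exI[of _ \<delta>] conjI exI[of _ C]) (auto simp: abs_mult)
qed

section \<open>The test problem of a tree\<close>

fun children :: "tw \<Rightarrow> tw list" where
  "children (Rnd m ts) = ts"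
| "children (Sq m t) = [t]"

text \<open>A list, since positions serve as coordinates. A subtree occurring repeatedly occupies
  several coordinates with equal equations, and \<open>pos\<close> later selects one of
  them.\<close>

fun subtrees :: "tw \<Rightarrow> tw list" where
  "subtrees (Rnd m ts) = Rnd m ts # concat (map subtrees ts)"
| "subtrees (Sq m t) = Sq m t # subtrees t"

lemma self_in_subtrees: "t \<in> set (subtrees t)"
  by (cases t) auto

lemma subtrees_children: "u \<in> set (subtrees t) \<Longrightarrow> set (children u) \<subseteq> set (subtrees t)"
proof (induction t)
  case (Rnd m ts)
  then show ?case using self_in_subtrees by (cases "u = Rnd m ts") fastforce+
next
  case (Sq m t)
  then show ?case using self_in_subtrees by (cases "u = Sq m t") fastforce+
qed

lemma wf_subtrees: "wf_tw N t \<Longrightarrow> u \<in> set (subtrees t) \<Longrightarrow> wf_tw N u"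
  by (induction t) auto

lemma rho_pos: "0 < rho t"
  by (cases t) auto

text \<open>One coordinate per subtree: a round vertex of colour m makes the m-th field multiply the
  coordinates of its children, a square vertex of colour m makes the m-th matrix copy the coordinate
  of its child. Started from 0, stages and solution are then single monomials in the step size.\<close>

locale tree_problem =
  fixes N :: nat and us :: "tw list" and pos :: "tw \<Rightarrow> nat"
  assumes pos: "\<And>u. u \<in> set us \<Longrightarrow> pos u < length us \<and> us ! pos u = u"
    and closed: "\<And>u. u \<in> set us \<Longrightarrow> set (children u) \<subseteq> set us"
    and wf: "\<And>u. u \<in> set us \<Longrightarrow> wf_tw N u"
begin

definition field :: "nat \<Rightarrow> (nat \<Rightarrow> real) \<Rightarrow> nat \<Rightarrow> real" where
  "field m x c = (if c < length us then (case us ! c of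
       Rnd m' ts \<Rightarrow> if m' = m then (\<Prod>u\<leftarrow>ts. x (pos u)) else 0 | Sq _ _ \<Rightarrow> 0) else 0)"

definition linear_part :: "nat \<Rightarrow> nat \<Rightarrow> nat \<Rightarrow> real" where
  "linear_part m c e = (case us ! c of
       Rnd _ _ \<Rightarrow> 0 | Sq m' u \<Rightarrow> if m' = m \<and> e = pos u then 1 else 0)"

definition solution :: "real \<Rightarrow> nat \<Rightarrow> real" where
  "solution h c = (if c < length us \<and> round_only (us ! c)
     then h ^ rho (us ! c) / real (dens (us ! c)) else 0)"

lemma smooth_field_field: "smooth_field (length us) (field m)"
  unfolding smooth_field_def
proof (intro conjI allI impI)
  fix c assume c: "c < length us"
  have zero: "smooth_fun (length us) (\<lambda>x. 0)"
    using smooth_monomial[of "[]" "length us" 0] by simp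
  show "smooth_fun (length us) (\<lambda>x. field m x c)"
  proof (cases "us ! c")
    case (Rnd m' ts)
    then have "set ts \<subseteq> set us" using closed[OF nth_mem[OF c]] by simp
    then have "set (map pos ts) \<subseteq> {..<length us}" using pos by auto
    from smooth_monomial[OF this, of 1] show ?thesis
      using c Rnd zero by (cases "m' = m") (simp_all add: field_def o_def)
  next
    case (Sq m' u)
    then show ?thesis using c zero by (simp add: field_def)
  qed
qed (simp add: field_def inV_def)

lemma prod_solution:
  assumes "set ts \<subseteq> set us"
  shows "(\<Prod>u\<leftarrow>ts. solution h (pos u)) = (if \<forall>u\<in>set ts. round_only u
    then h ^ sum_list (map rho ts) / real (prod_list (map dens ts)) else 0)"
  using assms
proof (induction ts)
  case (Cons u ts)
  then show ?case using pos[of u] by (simp add: solution_def power_add)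
qed auto

lemma exact_sol_solution: "exact_sol (length us) N field (\<lambda>_. 0) 1 solution"
  unfolding exact_sol_def
proof (intro conjI ballI allI impI)
  show "solution 0 = (\<lambda>_. 0)"
    by (auto simp: solution_def fun_eq_iff power_0_left) (metis rho_pos less_numeral_extra(3))
  fix h :: real assume "h \<in> {0..1}"
  show "inV (length us) (solution h)" by (auto simp: inV_def solution_def)
  fix c assume c: "c < length us"
  show "((\<lambda>\<tau>. solution \<tau> c) has_real_derivative (\<Sum>m<N. field m (solution h) c)) (at h within {0..1})"
  proof (cases "us ! c")
    case (Rnd m ts)
    have m: "m < N" "set ts \<subseteq> set us"
      using wf[OF nth_mem[OF c]] closed[OF nth_mem[OF c]] Rnd by auto
    have f: "(\<Sum>m<N. field m (solution h) c) = (\<Prod>u\<leftarrow>ts. solution h (pos u))"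
      using c Rnd m by (simp add: field_def)
    show ?thesis
    proof (cases "\<forall>u\<in>set ts. round_only u")
      case True
      \<comment> \<open>The children contribute h^n / D; integration gives the exponent n + 1 = rho
        and multiplies the denominator by n + 1, which is the recursion of the density.\<close>
      define n where "n = sum_list (map rho ts)"
      define D where "D = real (prod_list (map dens ts))"
      have "((\<lambda>\<tau>. \<tau> ^ Suc n / (real (Suc n) * D)) has_real_derivative
          real (Suc n) * h ^ (Suc n - Suc 0) / (real (Suc n) * D)) (at h within {0..1})"
        by (rule DERIV_cdivide[OF DERIV_pow])
      moreover have "real (Suc n) * h ^ (Suc n - Suc 0) / (real (Suc n) * D) = h ^ n / D"
        by (simp del: of_nat_Suc)
      ultimately show ?thesis
        using True c Rnd unfolding f prod_solution[OF m(2)] by (simp add: solution_def n_def D_def algebra_simps)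
    next
      case False
      then have "solution \<tau> c = 0" for \<tau> using c Rnd by (auto simp: solution_def)
      moreover have "(\<Prod>u\<leftarrow>ts. solution h (pos u)) = 0" unfolding prod_solution[OF m(2)] if_not_P[OF False] ..
      ultimately show ?thesis unfolding f by simp
    qed
  next
    case (Sq m u)
    then show ?thesis using c by (simp add: field_def solution_def)
  qed
qed

text \<open>Each coordinate depends only on coordinates of the children of its tree, so induction on
  the tree determines every stage solution, with one factor h per vertex. The implicit coupling
  through \<open>gam\<close> never leads back to the same tree.\<close>

lemma stage_value:
  assumes alpha: "\<And>q m i j. j \<ge> i \<Longrightarrow> alpha q m i j = 0"
    and gam: "\<And>q m i j. j > i \<Longrightarrow> gam q m i j = 0"
    and k: "stage_sol (length us) N s alpha gam field linear_part (\<lambda>_. 0) h k"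
    and "q < N" "i < s q" "c < length us"
  shows "k q i c = h ^ rho (us ! c) * theta N s alpha gam q (us ! c) i"
  using assms(4-6)
proof (induction "us ! c" arbitrary: c q i)
  case (Rnd m ts)
  have ts: "set ts \<subseteq> set us"
    using closed[OF nth_mem[of c]] Rnd.hyps(2)[symmetric] Rnd.prems by simp
  have "stage_arg N s alpha (\<lambda>_. 0) k q i (pos u)
      = h ^ rho u * (\<Sum>m<N. \<Sum>j<s m. alpha q m i j * theta N s alpha gam m u j)" if u: "u \<in> set ts" for u
  proof -
    have "(if j < i then alpha q m i j * k m j (pos u) else 0) = h ^ rho u * (alpha q m i j * theta N s alpha gam m u j)"
      if "m < N" "j < s m" for m j
    proof -
      have "us ! pos u = u" "pos u < length us" using pos u ts by auto
      then have "k m j (pos u) = h ^ rho u * theta N s alpha gam m u j"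
        using Rnd.hyps(1)[of "pos u" m j] u that by simp
      then show ?thesis by (simp add: alpha)
    qed
    then show ?thesis by (simp add: stage_arg_def sum_distrib_left)
  qed
  moreover have "(\<Prod>u\<leftarrow>ts. h ^ rho u * f u) = h ^ sum_list (map rho ts) * (\<Prod>u\<leftarrow>ts. f u)" for f
    by (induction ts) (auto simp: power_add mult_ac)
  ultimately have "(\<Prod>u\<leftarrow>ts. stage_arg N s alpha (\<lambda>_. 0) k q i (pos u))
      = h ^ sum_list (map rho ts) * (\<Prod>u\<leftarrow>ts. \<Sum>m<N. \<Sum>j<s m. alpha q m i j * theta N s alpha gam m u j)"
    by (metis (mono_tags, lifting) map_cong)
  moreover have "k q i c = h * field q (stage_arg N s alpha (\<lambda>_. 0) k q i) c"
    using k Rnd.prems Rnd.hyps(2)[symmetric] unfolding stage_sol_def by (simp add: linear_part_def)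
  ultimately show ?case
    using Rnd.prems Rnd.hyps(2)[symmetric] by (auto simp: field_def)
next
  case (Sq m u)
  have u: "u \<in> set us"
    using closed[OF nth_mem[of c]] Sq.hyps(2)[symmetric] Sq.prems by simp
  have "k q i c = h * (\<Sum>e<length us. linear_part q c e
      * (\<Sum>m<N. \<Sum>j<s m. if j \<le> i then gam q m i j * k m j e else 0))"
    using k Sq.prems Sq.hyps(2)[symmetric] unfolding stage_sol_def by (simp add: field_def)
  also have "\<dots> = h * (if m = q then \<Sum>m<N. \<Sum>j<s m. if j \<le> i then gam q m i j * k m j (pos u) else 0 else 0)"
    using pos[OF u] Sq.hyps(2)[symmetric]
    by (simp add: linear_part_def if_distrib[where f = "\<lambda>x. x * _"] cong: if_cong)
  also have "(\<Sum>m<N. \<Sum>j<s m. if j \<le> i then gam q m i j * k m j (pos u) else 0)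
      = (\<Sum>m<N. \<Sum>j<s m. h ^ rho u * (gam q m i j * theta N s alpha gam m u j))"
  proof (intro sum.cong refl)
    fix m j assume "m \<in> {..<N}" "j \<in> {..<s m}"
    then have "k m j (pos u) = h ^ rho u * theta N s alpha gam m u j"
      using Sq.hyps(1)[of "pos u" m j] pos[OF u] by simp
    then show "(if j \<le> i then gam q m i j * k m j (pos u) else 0)
        = h ^ rho u * (gam q m i j * theta N s alpha gam m u j)"
      by (simp add: gam)
  qed
  finally show ?case
    using Sq.hyps(2)[symmetric] by (simp add: sum_distrib_left mult_ac)
qed

end

text \<open>In the coordinate of \<open>t\<close> the local error is exactly h^rho times the defect
  of the order condition. Dividing the bound C h^(p+1) by h^rho leaves a positive power of h, and h
  tends to 0.\<close>

lemma order_imp_tree_condition: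
  assumes alpha: "\<And>q m i j. j \<ge> i \<Longrightarrow> alpha q m i j = 0"
    and gam: "\<And>q m i j. j > i \<Longrightarrow> gam q m i j = 0"
    and order: "gark_row_order N s b alpha gam p" and t: "wf_tw N t" "rho t \<le> p"
  shows "phi N s b alpha gam t = (if round_only t then 1 / real (dens t) else 0)"
proof -
  define us where "us = subtrees t"
  have "\<forall>u\<in>set us. \<exists>i. i < length us \<and> us ! i = u" by (simp add: in_set_conv_nth)
  then obtain pos where pos: "\<forall>u\<in>set us. pos u < length us \<and> us ! pos u = u" by metis
  interpret tree_problem N us pos
    using pos subtrees_children wf_subtrees[OF t(1)] by unfold_locales (auto simp: us_def)
  let ?E = "if round_only t then 1 / real (dens t) else 0"
  have t_pos: "pos t < length us" "us ! pos t = t" using pos self_in_subtrees[of t] by (auto simp: us_def)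
  have "\<exists>\<delta>>0. \<exists>C. \<forall>h. 0 < h \<and> h < \<delta> \<longrightarrow>
      (\<exists>k. stage_sol (length us) N s alpha gam field linear_part (\<lambda>_. 0) h k) \<and>
      (\<forall>k. stage_sol (length us) N s alpha gam field linear_part (\<lambda>_. 0) h k \<longrightarrow>
         (\<forall>c<length us. \<bar>num_sol N s b (\<lambda>_. 0) k c - solution h c\<bar> \<le> C * h ^ (p + 1)))"
    using order[unfolded gark_row_order_def, rule_format, OF smooth_field_field _ zero_less_one exact_sol_solution]
    by (simp add: inV_def)
  then obtain \<delta> C where \<delta>: "\<delta> > 0" and C: "\<And>h. 0 < h \<Longrightarrow> h < \<delta> \<Longrightarrow>
      (\<exists>k. stage_sol (length us) N s alpha gam field linear_part (\<lambda>_. 0) h k) \<and>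
      (\<forall>k. stage_sol (length us) N s alpha gam field linear_part (\<lambda>_. 0) h k \<longrightarrow>
         (\<forall>c<length us. \<bar>num_sol N s b (\<lambda>_. 0) k c - solution h c\<bar> \<le> C * h ^ (p + 1)))"
    by blast
  have bound: "\<bar>phi N s b alpha gam t - ?E\<bar> \<le> C * h ^ (p + 1 - rho t)" if h: "0 < h" "h < \<delta>" for h
  proof -
    obtain k where k: "stage_sol (length us) N s alpha gam field linear_part (\<lambda>_. 0) h k"
      and err: "\<bar>num_sol N s b (\<lambda>_. 0) k (pos t) - solution h (pos t)\<bar> \<le> C * h ^ (p + 1)"
      using C[OF h] t_pos(1) by blast
    have "k q i (pos t) = h ^ rho t * theta N s alpha gam q t i" if "q < N" "i < s q" for q i
      using stage_value[OF alpha gam k that t_pos(1)] t_pos(2) by simp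
    then have "num_sol N s b (\<lambda>_. 0) k (pos t) = h ^ rho t * phi N s b alpha gam t"
      by (simp add: num_sol_def phi_def sum_distrib_left mult_ac)
    moreover have "solution h (pos t) = h ^ rho t * ?E" using t_pos by (simp add: solution_def)
    moreover have "h ^ (p + 1) = h ^ rho t * h ^ (p + 1 - rho t)"
      using t(2) by (simp add: power_add[symmetric])
    ultimately have "h ^ rho t * \<bar>phi N s b alpha gam t - ?E\<bar> \<le> h ^ rho t * (C * h ^ (p + 1 - rho t))"
      using err h by (simp add: right_diff_distrib[symmetric] abs_mult mult_ac del: power_Suc)
    then show ?thesis using h by simp
  qed
  have "\<forall>\<^sub>F h in at_right 0. \<bar>phi N s b alpha gam t - ?E\<bar> \<le> C * h ^ (p + 1 - rho t)"
    unfolding eventually_at_right_field using bound \<delta> by (intro exI[of _ \<delta>]) auto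
  moreover have "((\<lambda>h::real. C * h ^ (p + 1 - rho t)) \<longlongrightarrow> C * 0 ^ (p + 1 - rho t)) (at_right 0)"
    by (intro tendsto_intros)
  ultimately have "\<bar>phi N s b alpha gam t - ?E\<bar> \<le> C * 0 ^ (p + 1 - rho t)"
    using tendsto_lowerbound[of _ _ "at_right (0::real)"] by fastforce
  then show ?thesis using t(2) by (simp add: power_0_left)
qed

theorem mainTheorem5:
  fixes N p :: nat and s :: "nat \<Rightarrow> nat" and b :: "nat \<Rightarrow> nat \<Rightarrow> real"
    and alpha gam :: "nat \<Rightarrow> nat \<Rightarrow> nat \<Rightarrow> nat \<Rightarrow> real"
  assumes "0 < N"
    and "\<And>q m i j. j \<ge> i \<Longrightarrow> alpha q m i j = 0"
    and "\<And>q m i j. j > i \<Longrightarrow> gam q m i j = 0"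
  shows "gark_row_order N s b alpha gam p \<longleftrightarrow>
    (\<forall>t. wf_tw N t \<and> 1 \<le> rho t \<and> rho t \<le> p \<longrightarrow>
       phi N s b alpha gam t = (if round_only t then 1 / real (dens t) else 0))"
proof
  assume "gark_row_order N s b alpha gam p"
  then show "\<forall>t. wf_tw N t \<and> 1 \<le> rho t \<and> rho t \<le> p \<longrightarrow>
       phi N s b alpha gam t = (if round_only t then 1 / real (dens t) else 0)"
    using order_imp_tree_condition[of alpha gam, OF assms(2,3)] by blast
next
  assume "\<forall>t. wf_tw N t \<and> 1 \<le> rho t \<and> rho t \<le> p \<longrightarrow>
       phi N s b alpha gam t = (if round_only t then 1 / real (dens t) else 0)"
  then have "phi N s b alpha gam t = (if round_only t then 1 / real (dens t) else 0)"
    if "wf_tw N t" "rho t \<le> p" for t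
    using that rho_pos[of t] by (simp add: Suc_leI)
  then show "gark_row_order N s b alpha gam p"
    by (intro tree_conditions_imp_order[of alpha gam, OF assms(2,3)])
qed

end
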